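(* There exists a monoidal structure on the category $\mathsf{pLagr}_R$ whose tensor product is defined by $$(H,\rho,s)\boxtimes(H',\rho',s'):=(H\oplus H',\ \rho\,{}_{s}\!\oplus_{s'}\rho',\ s+s')$$ for any objects $(H,\rho,s)$, $(H',\rho',s')$, and by $$N\boxtimes N':=N\oplus N'$$ for any morphisms $N:(H,\rho,s)\Rightarrow(K,\tau,t)$ and $N':(H',\rho',s')\Rightarrow(K',\tau',t')$ in $\mathsf{pLagr}_R$.
   Context: $R$ is a commutative ring without zero-divisors with an involutive ring homomorphism $r\mapsto\overline r$; $Q$ is its field of fractions with the extended involution; $H_Q=Q\otimes_RH$. A skew-Hermitian $R$-module $(H,\rho)$ is a finitely generated $R$-module $H$ with a form $\rho:H\times H\to R$ that is linear in the first variable, conjugate-linear in the second, satisfies $\rho(x,y)=-\overline{\rho(y,x)}$, and is non-degenerate ($x\mapsto\rho(x,\cdot)\in\operatorname{Hom}_R(H,R)$, $R$-valued maps, is injective as a map on $H$). Then $H$ is torsion-free, hence embeds in $H_Q$, and $\rho$ extends sesquilinearly to $H_Q$. A submodule $A$ is Lagrangian if $A=\operatorname{Ann}(A):=\{x\in H:\rho(x,A)=0\}$. Its closure is $\operatorname{cl}(A)=\{x\in H:\exists r\in R\setminus\{0\},\ rx\in A\}$. A pointed skew-Hermitian $R$-module $(H,\rho,s)$ is a skew-Hermitian module with $s\in H_Q$ such that $\rho(s,s)=0$ and $\rho(s,H)\subset R$. The category $\mathsf{pLagr}_R$ has these as objects; a morphism $N:(H_1,\rho_1,s_1)\Rightarrow(H_2,\rho_2,s_2)$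 is a Lagrangian submodule $N$ of $(H_1\oplus H_2,(-\rho_1)\oplus\rho_2)$ with $(s_1,s_2)\in N_Q$; composition is $N_2\circ N_1=\operatorname{cl}\{(h_1,h_3):\exists h_2\in H_2,\ (h_1,h_2)\in N_1,\ (h_2,h_3)\in N_2\}$; identities are diagonals. The form $\rho\,{}_{s}\!\oplus_{s'}\rho'$ on $H\oplus H'$ is $$(\rho\,{}_{s}\!\oplus_{s'}\rho')(h_1+h_1',h_2+h_2')=\rho(h_1,h_2)+\rho'(h_1',h_2')+\rho(h_1,s)\,\rho'(s',h_2')-\rho(s,h_2)\,\rho'(h_1',s').$$ $N\oplus N'\subset(H\oplus K)\oplus(H'\oplus K')$ is viewed in $(H\oplus H')\oplus(K\oplus K')$ by permuting summands. *)

theory Defs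
  imports "HOL-Algebra.Algebraic_Closure_Type"
begin

section \<open>Categories and monoidal categories\<close>

record ('o, 'f) category =
  Ob :: "'o set"
  Ar :: "'f set"
  Dom :: "'f \<Rightarrow> 'o"
  Cod :: "'f \<Rightarrow> 'o"
  Ident :: "'o \<Rightarrow> 'f"
  Comp :: "'f \<Rightarrow> 'f \<Rightarrow> 'f"  (infixr \<open>\<cdot>\<index>\<close> 65)

definition Hom :: "('o, 'f, 'z) category_scheme \<Rightarrow> 'o \<Rightarrow> 'o \<Rightarrow> 'f set" where
  "Hom C A B = {f \<in> Ar C. Dom C f = A \<and> Cod C f = B}"

locale category =
  fixes C (structure)
  assumes dom_ob: "f \<in> Ar C \<Longrightarrow> Dom C f \<in> Ob C"
    and cod_ob: "f \<in> Ar C \<Longrightarrow> Cod C f \<in> Ob C"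
    and ident_hom: "A \<in> Ob C \<Longrightarrow> Ident C A \<in> Hom C A A"
    and comp_hom: "\<lbrakk>f \<in> Hom C A B; g \<in> Hom C B D\<rbrakk> \<Longrightarrow> g \<cdot> f \<in> Hom C A D"
    and comp_ident: "f \<in> Hom C A B \<Longrightarrow> f \<cdot> Ident C A = f"
    and ident_comp: "f \<in> Hom C A B \<Longrightarrow> Ident C B \<cdot> f = f"
    and comp_assoc: "\<lbrakk>f \<in> Hom C A B; g \<in> Hom C B D; h \<in> Hom C D E\<rbrakk>
      \<Longrightarrow> (h \<cdot> g) \<cdot> f = h \<cdot> (g \<cdot> f)"

definition is_iso :: "('o, 'f, 'z) category_scheme \<Rightarrow> 'o \<Rightarrow> 'o \<Rightarrow> 'f \<Rightarrow> bool" where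
  "is_iso C A B f \<longleftrightarrow> f \<in> Hom C A B \<and>
    (\<exists>g \<in> Hom C B A. g \<cdot>\<^bsub>C\<^esub> f = Ident C A \<and> f \<cdot>\<^bsub>C\<^esub> g = Ident C B)"

record ('o, 'f) monoidal_category = "('o, 'f) category" +
  tensor_ob :: "'o \<Rightarrow> 'o \<Rightarrow> 'o"  (infixr \<open>\<boxtimes>\<index>\<close> 70)
  tensor_ar :: "'f \<Rightarrow> 'f \<Rightarrow> 'f"  (infixr \<open>\<star>\<index>\<close> 70)
  unit_ob :: 'o
  associator :: "'o \<Rightarrow> 'o \<Rightarrow> 'o \<Rightarrow> 'f"
  lunitor :: "'o \<Rightarrow> 'f"
  runitor :: "'o \<Rightarrow> 'f"

locale monoidal_category = category C for C (structure) +
  assumes tensor_ob_closed: "\<lbrakk>A \<in> Ob C; B \<in> Ob C\<rbrakk> \<Longrightarrow> A \<boxtimes> B \<in> Ob C"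
    and tensor_ar_hom: "\<lbrakk>f \<in> Hom C A B; f' \<in> Hom C A' B'\<rbrakk>
      \<Longrightarrow> f \<star> f' \<in> Hom C (A \<boxtimes> A') (B \<boxtimes> B')"
    and tensor_ident: "\<lbrakk>A \<in> Ob C; B \<in> Ob C\<rbrakk>
      \<Longrightarrow> Ident C A \<star> Ident C B = Ident C (A \<boxtimes> B)"
    and tensor_comp:
      "\<lbrakk>f \<in> Hom C A B; g \<in> Hom C B D; f' \<in> Hom C A' B'; g' \<in> Hom C B' D'\<rbrakk>
      \<Longrightarrow> (g \<cdot> f) \<star> (g' \<cdot> f') = (g \<star> g') \<cdot> (f \<star> f')"
    and unit_ob: "unit_ob C \<in> Ob C"
    and associator_iso: "\<lbrakk>A \<in> Ob C; B \<in> Ob C; D \<in> Ob C\<rbrakk>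
      \<Longrightarrow> is_iso C ((A \<boxtimes> B) \<boxtimes> D) (A \<boxtimes> (B \<boxtimes> D)) (associator C A B D)"
    and associator_natural:
      "\<lbrakk>f \<in> Hom C A A'; g \<in> Hom C B B'; h \<in> Hom C D D'\<rbrakk>
      \<Longrightarrow> associator C A' B' D' \<cdot> ((f \<star> g) \<star> h) = (f \<star> (g \<star> h)) \<cdot> associator C A B D"
    and lunitor_iso: "A \<in> Ob C \<Longrightarrow> is_iso C (unit_ob C \<boxtimes> A) A (lunitor C A)"
    and lunitor_natural: "f \<in> Hom C A B
      \<Longrightarrow> lunitor C B \<cdot> (Ident C (unit_ob C) \<star> f) = f \<cdot> lunitor C A"
    and runitor_iso: "A \<in> Ob C \<Longrightarrow> is_iso C (A \<boxtimes> unit_ob C) A (runitor C A)"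
    and runitor_natural: "f \<in> Hom C A B
      \<Longrightarrow> runitor C B \<cdot> (f \<star> Ident C (unit_ob C)) = f \<cdot> runitor C A"
    and pentagon: "\<lbrakk>A \<in> Ob C; B \<in> Ob C; D \<in> Ob C; E \<in> Ob C\<rbrakk>
      \<Longrightarrow> associator C A B (D \<boxtimes> E) \<cdot> associator C (A \<boxtimes> B) D E =
        (Ident C A \<star> associator C B D E) \<cdot> associator C A (B \<boxtimes> D) E
          \<cdot> (associator C A B D \<star> Ident C E)"
    and triangle: "\<lbrakk>A \<in> Ob C; B \<in> Ob C\<rbrakk>
      \<Longrightarrow> (Ident C A \<star> lunitor C B) \<cdot> associator C A (unit_ob C) B
        = runitor C A \<star> Ident C B"


section \<open>Modules over an integral domain\<close>

text \<open>
  The base ring \<open>R\<close> is a type \<open>'a :: idom\<close>, and an \<open>R\<close>-module is a \<open>module\<close> record over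
  the ring record of that type. Of such a record, only the carrier and the values of \<open>add\<close>,
  \<open>zero\<close> and \<open>smult\<close> on the carrier matter; the fields \<open>mult\<close> and \<open>one\<close>, inherited
  from \<open>ring\<close>, are never used. Likewise a form on the module is a function on the whole
  type of which only the values on the carrier matter.
\<close>

abbreviation base_ring :: "'a::idom ring" where
  "base_ring \<equiv> ring_of_type_algebra"

definition ring_involution :: "('a::idom \<Rightarrow> 'a) \<Rightarrow> bool" where
  "ring_involution bar \<longleftrightarrow>
    (\<forall>a b. bar (a + b) = bar a + bar b) \<and> (\<forall>a b. bar (a * b) = bar a * bar b) \<and>
    bar 1 = 1 \<and> (\<forall>a. bar (bar a) = a)"

definition finitely_generated :: "('a::idom, 'u, 'z) module_scheme \<Rightarrow> bool" where
  "finitely_generated M \<longleftrightarrow> (\<exists>S. finite S \<and> S \<subseteq> carrier M \<and>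
    (\<forall>x \<in> carrier M. \<exists>c. x = (\<Oplus>\<^bsub>M\<^esub>y\<in>S. c y \<odot>\<^bsub>M\<^esub> y)))"

definition module_sum ::
  "('a, 'u, 'y) module_scheme \<Rightarrow> ('a, 'v, 'z) module_scheme \<Rightarrow> ('a, 'u \<times> 'v) module" where
  "module_sum M M' = \<lparr>carrier = carrier M \<times> carrier M', monoid.mult = undefined, one = undefined,
    ring.zero = (\<zero>\<^bsub>M\<^esub>, \<zero>\<^bsub>M'\<^esub>),
    add = (\<lambda>(x, x') (y, y'). (x \<oplus>\<^bsub>M\<^esub> y, x' \<oplus>\<^bsub>M'\<^esub> y')),
    module.smult = (\<lambda>a (x, x'). (a \<odot>\<^bsub>M\<^esub> x, a \<odot>\<^bsub>M'\<^esub> x'))\<rparr>"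

text \<open>
  \<open>H\<^sub>Q\<close>, the extension of scalars to the field of fractions, is modelled as the module of
  fractions \<open>h/r\<close>. Its elements are equivalence classes of pairs \<open>(h, r)\<close> with
  \<open>r \<noteq> 0\<close>, the fraction \<open>h/r\<close> standing for \<open>(1/r) \<otimes> h\<close>.
\<close>

definition fraction_rel :: "('a::idom, 'u, 'z) module_scheme \<Rightarrow> (('u \<times> 'a) \<times> ('u \<times> 'a)) set" where
  "fraction_rel M = {((h, r), (k, t)). h \<in> carrier M \<and> k \<in> carrier M \<and> r \<noteq> 0 \<and> t \<noteq> 0 \<and>
    (\<exists>q. q \<noteq> 0 \<and> (q * t) \<odot>\<^bsub>M\<^esub> h = (q * r) \<odot>\<^bsub>M\<^esub> k)}"

definition fraction :: "('a::idom, 'u, 'z) module_scheme \<Rightarrow> 'u \<Rightarrow> 'a \<Rightarrow> ('u \<times> 'a) set" where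
  "fraction M h r = fraction_rel M `` {(h, r)}"

definition fractions :: "('a::idom, 'u, 'z) module_scheme \<Rightarrow> ('u \<times> 'a) set set" where
  "fractions M = (carrier M \<times> (UNIV - {0})) // fraction_rel M"

text \<open>The image of \<open>A\<^sub>Q\<close> in \<open>M\<^sub>Q\<close>, for a submodule \<open>A\<close> of \<open>M\<close>.\<close>

definition fractions_of :: "('a::idom, 'u, 'z) module_scheme \<Rightarrow> 'u set \<Rightarrow> ('u \<times> 'a) set set" where
  "fractions_of M A = {fraction M h r | h r. h \<in> A \<and> r \<noteq> 0}"

text \<open>
  The identification of \<open>H\<^sub>Q \<oplus> H'\<^sub>Q\<close> with \<open>(H \<oplus> H')\<^sub>Q\<close>: the fractions
  \<open>(h, h')/r\<close> equal to \<open>(s, s')\<close> are those with \<open>h/r = s\<close> and \<open>h'/r = s'\<close>.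
\<close>

definition fraction_pair ::
  "('u \<times> 'a) set \<Rightarrow> ('v \<times> 'a) set \<Rightarrow> (('u \<times> 'v) \<times> 'a) set" where
  "fraction_pair s s' = {((h, h'), r) | h h' r. (h, r) \<in> s \<and> (h', r) \<in> s'}"


section \<open>Skew-Hermitian modules and Lagrangian submodules\<close>

locale skew_hermitian_module = module "base_ring :: 'a::idom ring" M
  for M :: "('a::idom, 'u, 'z) module_scheme" (structure) +
  fixes bar :: "'a::idom \<Rightarrow> 'a" and \<rho> :: "'u \<Rightarrow> 'u \<Rightarrow> 'a::idom"
  assumes finitely_generated: "finitely_generated M"
    and form_add_left: "\<lbrakk>x \<in> carrier M; y \<in> carrier M; z \<in> carrier M\<rbrakk>
      \<Longrightarrow> \<rho> (x \<oplus> y) z = \<rho> x z + \<rho> y z"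
    and form_smult_left: "\<lbrakk>x \<in> carrier M; z \<in> carrier M\<rbrakk> \<Longrightarrow> \<rho> (a \<odot> x) z = a * \<rho> x z"
    and form_add_right: "\<lbrakk>x \<in> carrier M; y \<in> carrier M; z \<in> carrier M\<rbrakk>
      \<Longrightarrow> \<rho> z (x \<oplus> y) = \<rho> z x + \<rho> z y"
    and form_smult_right: "\<lbrakk>x \<in> carrier M; z \<in> carrier M\<rbrakk> \<Longrightarrow> \<rho> z (a \<odot> x) = bar a * \<rho> z x"
    and form_skew: "\<lbrakk>x \<in> carrier M; y \<in> carrier M\<rbrakk> \<Longrightarrow> \<rho> x y = - bar (\<rho> y x)"
    and form_nondegenerate: "inj_on (\<lambda>x. restrict (\<rho> x) (carrier M)) (carrier M)"

text \<open>
  The sesquilinear extension to \<open>H\<^sub>Q\<close>, with values in \<open>Q\<close>. The involution of \<open>Q\<close>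
  enters as \<open>bar (1/t) = 1/bar t\<close>.
\<close>

definition form_Q ::
  "('a::idom \<Rightarrow> 'a) \<Rightarrow> ('u \<Rightarrow> 'u \<Rightarrow> 'a) \<Rightarrow> ('u \<times> 'a) set \<Rightarrow> ('u \<times> 'a) set \<Rightarrow> 'a fract" where
  "form_Q bar \<rho> x y =
    (THE q. \<exists>h r k t. (h, r) \<in> x \<and> (k, t) \<in> y \<and> q = Fract (\<rho> h k) (r * bar t))"

definition annihilator ::
  "('a::idom, 'u, 'z) module_scheme \<Rightarrow> ('u \<Rightarrow> 'u \<Rightarrow> 'a) \<Rightarrow> 'u set \<Rightarrow> 'u set" where
  "annihilator M \<rho> A = {x \<in> carrier M. \<forall>a \<in> A. \<rho> x a = 0}"

definition lagrangian ::
  "('a::idom, 'u, 'z) module_scheme \<Rightarrow> ('u \<Rightarrow> 'u \<Rightarrow> 'a) \<Rightarrow> 'u set \<Rightarrow> bool" where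
  "lagrangian M \<rho> A \<longleftrightarrow> submodule A base_ring M \<and> A = annihilator M \<rho> A"

definition closure_in :: "('a::idom, 'u, 'z) module_scheme \<Rightarrow> 'u set \<Rightarrow> 'u set" where
  "closure_in M A = {x \<in> carrier M. \<exists>r. r \<noteq> 0 \<and> r \<odot>\<^bsub>M\<^esub> x \<in> A}"

text \<open>The form \<open>(-\<rho>\<^sub>1) \<oplus> \<rho>\<^sub>2\<close>.\<close>

definition diff_form ::
  "('u \<Rightarrow> 'u \<Rightarrow> 'a::idom) \<Rightarrow> ('v \<Rightarrow> 'v \<Rightarrow> 'a) \<Rightarrow> 'u \<times> 'v \<Rightarrow> 'u \<times> 'v \<Rightarrow> 'a" where
  "diff_form \<rho>1 \<rho>2 = (\<lambda>(x1, x2) (y1, y2). - \<rho>1 x1 y1 + \<rho>2 x2 y2)"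


section \<open>The category of pointed skew-Hermitian modules\<close>

type_synonym ('a, 'u) pointed_module =
  "('a, 'u) module \<times> ('u \<Rightarrow> 'u \<Rightarrow> 'a) \<times> ('u \<times> 'a) set"

definition pointed_skew_hermitian :: "('a::idom \<Rightarrow> 'a) \<Rightarrow> ('a, 'u) pointed_module \<Rightarrow> bool" where
  "pointed_skew_hermitian bar = (\<lambda>(M, \<rho>, s).
    skew_hermitian_module M bar \<rho> \<and> s \<in> fractions M \<and> form_Q bar \<rho> s s = 0 \<and>
    (\<forall>h \<in> carrier M. form_Q bar \<rho> s (fraction M h 1) \<in> range to_fract))"

definition lagrangian_relation ::
  "('a::idom, 'u) pointed_module \<Rightarrow> ('a, 'v) pointed_module \<Rightarrow> ('u \<times> 'v) set \<Rightarrow> bool" where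
  "lagrangian_relation = (\<lambda>(M1, \<rho>1, s1) (M2, \<rho>2, s2) N.
    lagrangian (module_sum M1 M2) (diff_form \<rho>1 \<rho>2) N \<and>
    fraction_pair s1 s2 \<in> fractions_of (module_sum M1 M2) N)"

text \<open>
  Objects are the pointed skew-Hermitian modules whose elements are taken from the type
  \<open>'u\<close>, which plays the role of the ambient universe; an arrow is a Lagrangian relation
  together with its domain and codomain.
\<close>

type_synonym ('a, 'u) pointed_relation =
  "('a, 'u) pointed_module \<times> ('a, 'u) pointed_module \<times> ('u \<times> 'u) set"

definition pLagr ::
  "('a::idom \<Rightarrow> 'a) \<Rightarrow> (('a, 'u) pointed_module, ('a, 'u) pointed_relation) category" where
  "pLagr bar = \<lparr>
    Ob = {A. pointed_skew_hermitian bar A},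
    Ar = {(A, B, N). pointed_skew_hermitian bar A \<and> pointed_skew_hermitian bar B \<and>
      lagrangian_relation A B N},
    Dom = (\<lambda>(A, B, N). A),
    Cod = (\<lambda>(A, B, N). B),
    Ident = (\<lambda>A. (A, A, {(h, h) | h. h \<in> carrier (fst A)})),
    Comp = (\<lambda>(B', D, N2) (A, B, N1). (A, D, closure_in (module_sum (fst A) (fst D))
      {(h1, h3). \<exists>h2 \<in> carrier (fst B). (h1, h2) \<in> N1 \<and> (h2, h3) \<in> N2}))\<rparr>"


section \<open>The tensor product\<close>

text \<open>
  The form \<open>\<rho> \<^sub>s\<oplus>\<^sub>s\<^sub>' \<rho>'\<close> on \<open>H \<oplus> H'\<close>. For pointed modules the values
  of the extended forms that occur lie in \<open>R\<close>, and \<open>the_inv to_fract\<close> reads them as elements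
  of \<open>R\<close>.
\<close>

definition twisted_form ::
  "('a::idom \<Rightarrow> 'a) \<Rightarrow> ('a, 'u) pointed_module \<Rightarrow> ('a, 'v) pointed_module \<Rightarrow>
    'u \<times> 'v \<Rightarrow> 'u \<times> 'v \<Rightarrow> 'a" where
  "twisted_form bar = (\<lambda>(M, \<rho>, s) (M', \<rho>', s') (h1, h1') (h2, h2').
    \<rho> h1 h2 + \<rho>' h1' h2'
    + the_inv to_fract (form_Q bar \<rho> (fraction M h1 1) s)
        * the_inv to_fract (form_Q bar \<rho>' s' (fraction M' h2' 1))
    - the_inv to_fract (form_Q bar \<rho> s (fraction M h2 1))
        * the_inv to_fract (form_Q bar \<rho>' (fraction M' h1' 1) s'))"

text \<open>
  The elements of \<open>H \<oplus> H'\<close> are pairs, of type \<open>'u \<times> 'u\<close>. To obtain an object with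
  elements in the universe \<open>'u\<close>, the structure is transported along an injective pairing
  \<open>'u \<times> 'u \<Rightarrow> 'u\<close>.
\<close>

definition transport_module :: "('v \<Rightarrow> 'u) \<Rightarrow> ('a, 'v) module \<Rightarrow> ('a, 'u) module" where
  "transport_module \<phi> M = (let \<psi> = inv_into (carrier M) \<phi> in
    \<lparr>carrier = \<phi> ` carrier M, monoid.mult = undefined, one = undefined, ring.zero = \<phi> \<zero>\<^bsub>M\<^esub>,
     add = (\<lambda>x y. \<phi> (\<psi> x \<oplus>\<^bsub>M\<^esub> \<psi> y)), module.smult = (\<lambda>a x. \<phi> (a \<odot>\<^bsub>M\<^esub> \<psi> x))\<rparr>)"

definition transport :: "('v \<Rightarrow> 'u) \<Rightarrow> ('a, 'v) pointed_module \<Rightarrow> ('a, 'u) pointed_module" where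
  "transport \<phi> = (\<lambda>(M, \<rho>, s). let \<psi> = inv_into (carrier M) \<phi> in
    (transport_module \<phi> M, (\<lambda>x y. \<rho> (\<psi> x) (\<psi> y)), {(\<phi> h, r) | h r. (h, r) \<in> s}))"

text \<open>\<open>N \<oplus> N'\<close> with the middle summands interchanged.\<close>

definition relation_sum :: "('u \<times> 'u \<Rightarrow> 'u) \<Rightarrow> ('u \<times> 'u) set \<Rightarrow> ('u \<times> 'u) set \<Rightarrow> ('u \<times> 'u) set" where
  "relation_sum pair N N' = {(pair (h, h'), pair (k, k')) | h k h' k'. (h, k) \<in> N \<and> (h', k') \<in> N'}"

end

theory Submission
  imports Defs
begin

text \<open>
  By non-degeneracy, a relation \<open>N\<close> is Lagrangian iff \<open>(x, y) \<in> N\<close> is equivalent to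
  \<open>\<rho>(x, a) = \<tau>(y, b)\<close> for all \<open>(a, b) \<in> N\<close>. That the closed composite of two Lagrangian
  relations is Lagrangian then amounts to finite-dimensional duality: a functional vanishing on the
  common kernel of a family of functionals is, up to a non-zero scalar, a combination of them. This is
  applied to functionals on \<open>H\<^sub>1 \<oplus> H\<^sub>2 \<oplus> H\<^sub>3\<close>, written in terms of finitely many
  generators.

  For \<open>(x, y) \<in> N\<close>, the condition \<open>(s, t) \<in> N\<^sub>Q\<close> gives \<open>\<rho>(x, s) = \<tau>(y, t)\<close>, so that
  the mixed terms of the twisted forms cancel on \<open>N \<oplus> N'\<close>. The structure morphisms are graphs of
  isometries preserving the points; composition with such a graph needs no closure, which reduces
  coherence to identities between maps.
\<close>

section \<open>Linear algebra over an integral domain\<close>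

text \<open>The base is only a domain, so no vector space over Q is formed: statements about
  fractions are read with denominators cleared, and torsion-freeness, a consequence of
  non-degeneracy, permits cancellation. This also explains the closure in the composition law:
  duality produces the middle element only for a non-zero multiple of (x, z), while a Lagrangian
  submodule is stable under division by non-zero scalars. The points enter the twisted forms only
  through the two R-valued functionals \<rho>(s, .) and \<rho>(., s). Three facts control them: they
  are invariant along morphisms, they vanish on s because s is isotropic, and they add up on tensor
  products. The last one settles triple products, where either bracketing yields one mixed
  contribution for each pair of factors. Pairs are coded in the universe by \<open>pair\<close>, of
  which nothing but injectivity is known, so associativity holds only up to an isometry that
  rebrackets codes.\<close>

text \<open>\<open>F\<close> is a submodule of the functionals \<open>z \<mapsto> (\<Sum>i\<in>T. z i * f i)\<close>.\<close>

lemma functional_combination: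
  fixes F :: "('i \<Rightarrow> 'a::idom) set"
  assumes "finite T" and "F \<noteq> {}"
    and "\<And>f f'. f \<in> F \<Longrightarrow> f' \<in> F \<Longrightarrow> (\<lambda>i. f i + f' i) \<in> F"
    and "\<And>c f. f \<in> F \<Longrightarrow> (\<lambda>i. c * f i) \<in> F"
    and "\<And>z. \<forall>f\<in>F. (\<Sum>i\<in>T. z i * f i) = 0 \<Longrightarrow> (\<Sum>i\<in>T. z i * g i) = 0"
  shows "\<exists>r f. r \<noteq> 0 \<and> f \<in> F \<and> (\<forall>i\<in>T. r * g i = f i)"
  using assms
proof (induction T arbitrary: F g rule: finite_induct)
  case empty
  then obtain f where "f \<in> F" by blast
  then show ?case by (intro exI[of _ 1] exI[of _ f]) auto
next
  case (insert t T)
  have zt: "(\<Sum>i\<in>T. (z(t := c)) i * f i) = (\<Sum>i\<in>T. z i * f i)" for z c and f :: "'i \<Rightarrow> 'a"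
    using insert.hyps by (intro sum.cong) auto
  show ?case
  proof (cases "\<exists>f0\<in>F. f0 t \<noteq> 0")
    case True
    then obtain f0 where f0: "f0 \<in> F" "f0 t \<noteq> 0" by blast
    define F' where "F' = {f \<in> F. f t = 0}"
    \<comment> \<open>Elimination without division: the coordinate \<open>t\<close> of
      \<open>g\<close> is cleared by cross-multiplying with \<open>f0\<close>, which costs the
      factor \<open>f0 t\<close>.\<close>
    define g' where "g' = (\<lambda>i. f0 t * g i + - g t * f0 i)"
    have elim: "(\<lambda>i. f0 t * f i + - f t * f0 i) \<in> F'" if "f \<in> F" for f
    proof -
      have "(\<lambda>i. f0 t * f i) \<in> F" "(\<lambda>i. - f t * f0 i) \<in> F"
        using that f0(1) insert.prems(3) by blast+
      then show ?thesis unfolding F'_def using insert.prems(2)[of "\<lambda>i. f0 t * f i" "\<lambda>i. - f t * f0 i"] by auto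
    qed
    have "\<exists>r f. r \<noteq> 0 \<and> f \<in> F' \<and> (\<forall>i\<in>T. r * g' i = f i)"
    proof (rule insert.IH)
      show "F' \<noteq> {}" using elim[OF f0(1)] by blast
      show "(\<lambda>i. f i + f' i) \<in> F'" if "f \<in> F'" "f' \<in> F'" for f f'
        using that insert.prems(2) by (auto simp: F'_def)
      show "(\<lambda>i. c * f i) \<in> F'" if "f \<in> F'" for c f
        using that insert.prems(3) by (auto simp: F'_def)
      fix z assume z: "\<forall>f\<in>F'. (\<Sum>i\<in>T. z i * f i) = 0"
      \<comment> \<open>The value at \<open>t\<close> is chosen so that \<open>z'\<close> kills
        \<open>f0\<close>; the factor \<open>f0 t\<close> keeps it in the ring. Pairing
        \<open>f\<close> with \<open>z'\<close> is pairing the eliminated \<open>f\<close> with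
        \<open>z\<close>, so \<open>z'\<close> kills all of \<open>F\<close>, hence
        \<open>g\<close>.\<close>
      define z' where "z' = (\<lambda>i. f0 t * z i)(t := - (\<Sum>i\<in>T. z i * f0 i))"
      have z': "(\<Sum>i\<in>insert t T. z' i * f i) = (\<Sum>i\<in>T. z i * (f0 t * f i + - f t * f0 i))" for f
      proof -
        have "(\<Sum>i\<in>insert t T. z' i * f i) =
            - (\<Sum>i\<in>T. z i * f0 i) * f t + (\<Sum>i\<in>T. f0 t * z i * f i)"
          by (simp only: z'_def sum.insert[OF insert.hyps] zt fun_upd_same)
        then show ?thesis
          by (simp add: algebra_simps sum_distrib_left sum_subtractf)
      qed
      show "(\<Sum>i\<in>T. z i * g' i) = 0"
        using insert.prems(4)[of z'] bspec[OF z elim] unfolding z' g'_def by simp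
    qed
    then obtain r f where rf: "r \<noteq> 0" "f \<in> F'" "\<forall>i\<in>T. r * g' i = f i" by blast
    \<comment> \<open>Undoes the elimination. The new index \<open>t\<close> causes no trouble,
      since \<open>g' t\<close> and \<open>f t\<close> are both zero.\<close>
    let ?f = "\<lambda>i. f i + r * g t * f0 i"
    have "?f \<in> F"
      using rf(2) f0(1) insert.prems(2,3) by (auto simp: F'_def)
    moreover have "r * f0 t * g i = ?f i" if "i \<in> insert t T" for i
    proof -
      have "r * g' i = f i" using that rf(2,3) by (auto simp: F'_def g'_def)
      then show ?thesis by (simp add: g'_def algebra_simps)
    qed
    ultimately show ?thesis using rf(1) f0(2)
      by (intro exI[of _ "r * f0 t"] exI[of _ ?f]) auto
  next
    case False
    \<comment> \<open>In this case the unit vector at \<open>t\<close> is killed by all of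
      \<open>F\<close>, hence by \<open>g\<close>.\<close>
    have gt: "g t = 0"
      using insert.prems(4)[of "(\<lambda>i. 0)(t := 1)"] False
      by (simp add: sum.insert[OF insert.hyps] zt fun_upd_same del: fun_upd_apply)
    have "\<exists>r f. r \<noteq> 0 \<and> f \<in> F \<and> (\<forall>i\<in>T. r * g i = f i)"
    proof (rule insert.IH[OF insert.prems(1-3)])
      fix z assume "\<forall>f\<in>F. (\<Sum>i\<in>T. z i * f i) = 0"
      then show "(\<Sum>i\<in>T. z i * g i) = 0"
        using insert.prems(4)[of "z(t := 0)"]
        by (simp add: sum.insert[OF insert.hyps] zt fun_upd_same del: fun_upd_apply)
    qed
    then show ?thesis using False gt by force
  qed
qed


section \<open>Skew-Hermitian modules\<close>

lemma base_ring_simps [simp]: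
  "carrier base_ring = UNIV" "x \<oplus>\<^bsub>base_ring\<^esub> y = x + y" "x \<otimes>\<^bsub>base_ring\<^esub> y = x * y"
  "\<one>\<^bsub>base_ring\<^esub> = 1" "\<zero>\<^bsub>base_ring\<^esub> = 0"
  by (auto simp: ring_of_type_algebra_def)

lemma ring_involution_simps:
  assumes "ring_involution bar"
  shows "bar (a + b) = bar a + bar b" "bar (a * b) = bar a * bar b" "bar 1 = 1"
    "bar (bar a) = a" "bar 0 = 0" "bar (- a) = - bar a" "bar a = 0 \<longleftrightarrow> a = 0"
    "bar (a - b) = bar a - bar b"
proof -
  show add: "bar (a + b) = bar a + bar b" for a b using assms by (simp add: ring_involution_def)
  show "bar (a * b) = bar a * bar b" "bar 1 = 1" using assms by (simp_all add: ring_involution_def)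
  show bb: "bar (bar a) = a" for a using assms by (simp add: ring_involution_def)
  show z: "bar 0 = 0" using add[of 0 0] by (metis add_0 add_cancel_right_right)
  show minus: "bar (- a) = - bar a" for a using add[of a "- a"] z by (simp add: eq_neg_iff_add_eq_0 add.commute)
  show "bar a = 0 \<longleftrightarrow> a = 0" using bb[of a] z by auto
  show "bar (a - b) = bar a - bar b" using add[of a "- b"] minus[of b] by simp
qed

text \<open>The involution is fixed once for all modules, so its laws are not among the axioms of a
  single skew-Hermitian module; here they are joined to them.\<close>

locale skew_hermitian_involution = skew_hermitian_module M bar \<rho>
  for M :: "('a::idom, 'u, 'z) module_scheme" (structure) and bar and \<rho> +
  assumes involution: "ring_involution bar"
begin

lemmas bar_simps [simp] = ring_involution_simps[OF involution]

lemma smult_mem [simp]: "x \<in> carrier M \<Longrightarrow> a \<odot> x \<in> carrier M"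
  by simp

lemma smult_smult: "x \<in> carrier M \<Longrightarrow> a \<odot> (b \<odot> x) = (a * b) \<odot> x"
  using smult_assoc1[of a b x] by simp

lemma one_smult [simp]: "x \<in> carrier M \<Longrightarrow> 1 \<odot> x = x"
  using smult_one[of x] by simp

lemma form_zero_left [simp]: "x \<in> carrier M \<Longrightarrow> \<rho> \<zero> x = 0"
  using form_smult_left[of \<zero> x 0] smult_l_null[of \<zero>] by simp

lemma form_zero_right [simp]: "x \<in> carrier M \<Longrightarrow> \<rho> x \<zero> = 0"
  using form_smult_right[of \<zero> x 0] smult_l_null[of \<zero>] by simp

lemma form_eqI:
  assumes "x \<in> carrier M" "y \<in> carrier M" "\<And>z. z \<in> carrier M \<Longrightarrow> \<rho> x z = \<rho> y z"
  shows "x = y"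
  using form_nondegenerate assms by (auto simp: inj_on_def fun_eq_iff)

lemma form_eqI_right:
  assumes "x \<in> carrier M" "y \<in> carrier M" "\<And>z. z \<in> carrier M \<Longrightarrow> \<rho> z x = \<rho> z y"
  shows "x = y"
proof (rule form_eqI[OF assms(1,2)])
  fix z assume "z \<in> carrier M"
  then show "\<rho> x z = \<rho> y z" using assms form_skew[of x z] form_skew[of y z] by simp
qed

text \<open>Torsion-freeness: the values of the form lie in a domain, where \<open>r\<close> can be
  cancelled, and non-degeneracy carries this back to the module.\<close>

lemma smult_cancel:
  assumes "r \<noteq> 0" "x \<in> carrier M" "y \<in> carrier M" "r \<odot> x = r \<odot> y"
  shows "x = y"
proof (rule form_eqI[OF assms(2,3)])
  fix z assume "z \<in> carrier M"
  then show "\<rho> x z = \<rho> y z"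
    using assms form_smult_left[of x z r] form_smult_left[of y z r] by simp
qed

lemma form_finsum_left:
  assumes "finite S" "S \<subseteq> carrier M" "w \<in> carrier M"
  shows "\<rho> (\<Oplus>y\<in>S. c y \<odot> y) w = (\<Sum>y\<in>S. c y * \<rho> y w)"
  using assms
proof (induction S rule: finite_induct)
  case (insert y S)
  have "(\<lambda>y. c y \<odot> y) \<in> S \<rightarrow> carrier M" using insert by auto
  then show ?case using insert by (simp add: form_add_left form_smult_left)
qed simp

text \<open>The auxiliary factor \<open>q\<close> of the localisation is cancelled by
  torsion-freeness, leaving plain cross-multiplication.\<close>

lemma fraction_rel_iff:
  "((h, r), (k, t)) \<in> fraction_rel M \<longleftrightarrow>
    h \<in> carrier M \<and> k \<in> carrier M \<and> r \<noteq> 0 \<and> t \<noteq> 0 \<and> t \<odot> h = r \<odot> k"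
proof -
  have "t \<odot> h = r \<odot> k"
    if "h \<in> carrier M" "k \<in> carrier M" "q \<noteq> 0" "(q * t) \<odot> h = (q * r) \<odot> k" for q
    using that smult_cancel[of q "t \<odot> h" "r \<odot> k"] by (simp add: smult_smult)
  then show ?thesis unfolding fraction_rel_def by (auto intro: exI[of _ 1])
qed

lemma mem_fraction:
  assumes "h \<in> carrier M" "r \<noteq> 0"
  shows "(k, t) \<in> fraction M h r \<longleftrightarrow> k \<in> carrier M \<and> t \<noteq> 0 \<and> t \<odot> h = r \<odot> k"
  using assms by (simp add: fraction_def fraction_rel_iff)

lemma fractions_iff: "s \<in> fractions M \<longleftrightarrow> (\<exists>h\<in>carrier M. \<exists>r. r \<noteq> 0 \<and> s = fraction M h r)"
  unfolding fractions_def quotient_def fraction_def by auto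

lemma fraction_in_fractions [simp]: "h \<in> carrier M \<Longrightarrow> r \<noteq> 0 \<Longrightarrow> fraction M h r \<in> fractions M"
  using fractions_iff by blast

text \<open>Takes the place of symmetry and transitivity of \<open>fraction_rel\<close>: every
  member of a class may serve as its representative.\<close>

lemma fractions_memD:
  assumes "s \<in> fractions M" "(h, r) \<in> s"
  shows "h \<in> carrier M" "r \<noteq> 0" "s = fraction M h r"
proof -
  obtain h0 r0 where s: "h0 \<in> carrier M" "r0 \<noteq> 0" "s = fraction M h0 r0"
    using assms(1) fractions_iff by blast
  then show hr: "h \<in> carrier M" "r \<noteq> 0" using assms(2) by (auto simp: mem_fraction)
  have e: "r \<odot> h0 = r0 \<odot> h" using s assms(2) by (auto simp: mem_fraction)
  have "t \<odot> h0 = r0 \<odot> k \<longleftrightarrow> t \<odot> h = r \<odot> k" if k: "k \<in> carrier M" for k t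
  proof -
    \<comment> \<open>Multiplying by \<open>t\<close> makes the two cross-multiplication equations
      comparable; the factors \<open>r\<close> and \<open>r0\<close> are then cancelled.\<close>
    have 1: "(r * t) \<odot> h0 = (r0 * t) \<odot> h"
      using arg_cong[OF e, of "\<lambda>x. t \<odot> x"] s hr by (simp add: smult_smult mult.commute)
    have "t \<odot> h0 = r0 \<odot> k \<longleftrightarrow> r \<odot> (t \<odot> h0) = r \<odot> (r0 \<odot> k)"
      using smult_cancel[OF hr(2), of "t \<odot> h0" "r0 \<odot> k"] s k by auto
    also have "\<dots> \<longleftrightarrow> r0 \<odot> (t \<odot> h) = r0 \<odot> (r \<odot> k)"
      using s hr k 1 by (simp add: smult_smult mult.commute)
    also have "\<dots> \<longleftrightarrow> t \<odot> h = r \<odot> k"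
      using smult_cancel[OF s(2), of "t \<odot> h" "r \<odot> k"] hr k by auto
    finally show ?thesis .
  qed
  then show "s = fraction M h r"
    using s hr by (auto simp: mem_fraction)
qed

text \<open>Well-definedness of the extension. Cross-multiplying representatives in both arguments
  and expanding sesquilinearly gives exactly the equality of the two quotients.\<close>

lemma form_Q_eq:
  assumes "x \<in> fractions M" "y \<in> fractions M" "(h, r) \<in> x" "(k, t) \<in> y"
  shows "form_Q bar \<rho> x y = Fract (\<rho> h k) (r * bar t)"
  unfolding form_Q_def
proof (rule the_equality)
  show "\<exists>h' r' k' t'. (h', r') \<in> x \<and> (k', t') \<in> y \<and> Fract (\<rho> h k) (r * bar t) = Fract (\<rho> h' k') (r' * bar t')"
    using assms by blast
  fix q assume "\<exists>h' r' k' t'. (h', r') \<in> x \<and> (k', t') \<in> y \<and> q = Fract (\<rho> h' k') (r' * bar t')"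
  then obtain h' r' k' t' where *: "(h', r') \<in> x" "(k', t') \<in> y" "q = Fract (\<rho> h' k') (r' * bar t')"
    by blast
  note hr = fractions_memD[OF assms(1,3)] and kt = fractions_memD[OF assms(2,4)]
    and hr' = fractions_memD[OF assms(1) *(1)] and kt' = fractions_memD[OF assms(2) *(2)]
  have "r' \<odot> h = r \<odot> h'" "t' \<odot> k = t \<odot> k'"
    using hr kt *(1,2) by (auto simp: mem_fraction)
  then have "\<rho> (r \<odot> h') (t \<odot> k') = \<rho> (r' \<odot> h) (t' \<odot> k)" by simp
  then have "\<rho> h' k' * (r * bar t) = \<rho> h k * (r' * bar t')"
    using hr kt hr' kt' by (simp add: form_smult_left form_smult_right mult.commute mult.left_commute)
  then show "q = Fract (\<rho> h k) (r * bar t)"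
    using hr kt hr' kt' *(3) by (simp add: eq_fract mult.commute mult.left_commute)
qed

end

section \<open>Module axioms and direct sums\<close>

lemma module_sum_simps [simp]:
  "carrier (module_sum M M') = carrier M \<times> carrier M'"
  "(x, x') \<oplus>\<^bsub>module_sum M M'\<^esub> (y, y') = (x \<oplus>\<^bsub>M\<^esub> y, x' \<oplus>\<^bsub>M'\<^esub> y')"
  "\<zero>\<^bsub>module_sum M M'\<^esub> = (\<zero>\<^bsub>M\<^esub>, \<zero>\<^bsub>M'\<^esub>)"
  "a \<odot>\<^bsub>module_sum M M'\<^esub> (x, x') = (a \<odot>\<^bsub>M\<^esub> x, a \<odot>\<^bsub>M'\<^esub> x')"
  by (simp_all add: module_sum_def)

text \<open>Additive inverses arise as multiples by -1, using distributivity and the law for the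
  scalar 0.\<close>

lemma module_base_ringI:
  fixes M :: "('a::idom, 'u, 'z) module_scheme" (structure)
  assumes "\<zero> \<in> carrier M"
    and "\<And>x y. x \<in> carrier M \<Longrightarrow> y \<in> carrier M \<Longrightarrow> x \<oplus> y \<in> carrier M"
    and "\<And>x y z. x \<in> carrier M \<Longrightarrow> y \<in> carrier M \<Longrightarrow> z \<in> carrier M \<Longrightarrow>
      (x \<oplus> y) \<oplus> z = x \<oplus> (y \<oplus> z)"
    and "\<And>x y. x \<in> carrier M \<Longrightarrow> y \<in> carrier M \<Longrightarrow> x \<oplus> y = y \<oplus> x"
    and "\<And>x. x \<in> carrier M \<Longrightarrow> \<zero> \<oplus> x = x"
    and "\<And>a x. x \<in> carrier M \<Longrightarrow> a \<odot> x \<in> carrier M"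
    and "\<And>a b x. x \<in> carrier M \<Longrightarrow> (a + b) \<odot> x = a \<odot> x \<oplus> b \<odot> x"
    and "\<And>a x y. x \<in> carrier M \<Longrightarrow> y \<in> carrier M \<Longrightarrow> a \<odot> (x \<oplus> y) = a \<odot> x \<oplus> a \<odot> y"
    and "\<And>a b x. x \<in> carrier M \<Longrightarrow> (a * b) \<odot> x = a \<odot> (b \<odot> x)"
    and "\<And>x. x \<in> carrier M \<Longrightarrow> 1 \<odot> x = x"
    and "\<And>x. x \<in> carrier M \<Longrightarrow> 0 \<odot> x = \<zero>"
  shows "module base_ring M"
proof (rule moduleI)
  show "cring (base_ring :: 'a ring)" ..
  show "abelian_group M"
  proof (rule abelian_groupI)
    fix x assume x: "x \<in> carrier M"
    have "(- 1) \<odot> x \<oplus> x = (- 1 + 1) \<odot> x"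
      using assms(7)[OF x, of "- 1" 1] assms(10)[OF x] by simp
    then have "(- 1) \<odot> x \<oplus> x = \<zero>" using assms(11)[OF x] by simp
    then show "\<exists>y\<in>carrier M. y \<oplus> x = \<zero>" using assms(6)[OF x] by blast
  qed (use assms in auto)
qed (use assms in auto)

lemma module_base_ring_simps:
  fixes M :: "('a::idom, 'u, 'z) module_scheme" (structure)
  assumes "module base_ring M" and "x \<in> carrier M" and "y \<in> carrier M"
  shows "a \<odot> x \<in> carrier M" "(a + b) \<odot> x = a \<odot> x \<oplus> b \<odot> x"
    "a \<odot> (x \<oplus> y) = a \<odot> x \<oplus> a \<odot> y" "(a * b) \<odot> x = a \<odot> (b \<odot> x)" "1 \<odot> x = x" "0 \<odot> x = \<zero>"
proof -
  interpret module base_ring M by fact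
  show "a \<odot> x \<in> carrier M" "(a + b) \<odot> x = a \<odot> x \<oplus> b \<odot> x"
    "a \<odot> (x \<oplus> y) = a \<odot> x \<oplus> a \<odot> y" "(a * b) \<odot> x = a \<odot> (b \<odot> x)" "1 \<odot> x = x" "0 \<odot> x = \<zero>"
    using assms(2,3) smult_l_distr[of a b x] smult_r_distr[of a x y] smult_assoc1[of a b x]
      smult_one[of x] smult_l_null[of x] by simp_all
qed

lemma module_module_sum:
  assumes "module base_ring M" and "module base_ring M'"
  shows "module base_ring (module_sum M M')"
proof -
  interpret M: module base_ring M by fact
  interpret M': module base_ring M' by fact
  note rules = module_base_ring_simps[OF assms(1)] module_base_ring_simps[OF assms(2)]
  show ?thesis
    by (rule module_base_ringI)
      (auto simp: rules M.M.a_assoc M'.M.a_assoc intro: M.M.a_comm M'.M.a_comm)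
qed

section \<open>Pairing with the distinguished point\<close>

abbreviation elems :: "('a, 'u) pointed_module \<Rightarrow> 'u set" where
  "elems A \<equiv> carrier (fst A)"

abbreviation form :: "('a, 'u) pointed_module \<Rightarrow> 'u \<Rightarrow> 'u \<Rightarrow> 'a" where
  "form A \<equiv> fst (snd A)"

abbreviation point :: "('a, 'u) pointed_module \<Rightarrow> ('u \<times> 'a) set" where
  "point A \<equiv> snd (snd A)"

text \<open>The functional \<rho>(s, .); the next definition is \<rho>(., s). They are the factors
  of the mixed terms in the twisted form, and having them R-valued confines Q to few places.\<close>

definition from_point :: "('a::idom \<Rightarrow> 'a) \<Rightarrow> ('a, 'u) pointed_module \<Rightarrow> 'u \<Rightarrow> 'a" where
  "from_point bar A h = the_inv to_fract (form_Q bar (form A) (point A) (fraction (fst A) h 1))"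

definition to_point :: "('a::idom \<Rightarrow> 'a) \<Rightarrow> ('a, 'u) pointed_module \<Rightarrow> 'u \<Rightarrow> 'a" where
  "to_point bar A h = the_inv to_fract (form_Q bar (form A) (fraction (fst A) h 1) (point A))"

lemma the_inv_to_fract:
  assumes "b \<noteq> 0" and "a = b * c"
  shows "the_inv to_fract (Fract a b) = c"
proof -
  have "Fract a b = to_fract c" using assms by (simp add: to_fract_def eq_fract)
  then show ?thesis by (simp add: the_inv_f_f inj_def)
qed

lemma Fract_in_range_to_fract:
  assumes "b \<noteq> 0"
  shows "Fract a b \<in> range to_fract \<longleftrightarrow> b dvd a"
  using assms by (auto simp: to_fract_def eq_fract dvd_def mult.commute)

locale pointed_object =
  fixes bar :: "'a::idom \<Rightarrow> 'a" and A :: "('a, 'u) pointed_module"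
  assumes involution_bar: "ring_involution bar"
    and pointed: "pointed_skew_hermitian bar A"

sublocale pointed_object \<subseteq> skew_hermitian_involution "fst A" bar "form A"
  using involution_bar pointed
  by (cases A) (auto simp: skew_hermitian_involution_def skew_hermitian_involution_axioms_def
      pointed_skew_hermitian_def)

text \<open>For s = h/r, integrality of \<rho>(s, x) means divisibility of \<open>\<rho> h x\<close>
  by \<open>r\<close>. New pointed objects, namely tensor products and the unit, are recognised in
  this way.\<close>

lemma (in skew_hermitian_involution) pointed_skew_hermitianI:
  assumes "h \<in> carrier M" "r \<noteq> 0" "\<rho> h h = 0" "\<And>x. x \<in> carrier M \<Longrightarrow> r dvd \<rho> h x"
  shows "form_Q bar \<rho> (fraction M h r) (fraction M h r) = 0"
    "\<forall>x\<in>carrier M. form_Q bar \<rho> (fraction M h r) (fraction M x 1) \<in> range to_fract"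
proof -
  have hr: "(h, r) \<in> fraction M h r" using assms by (simp add: mem_fraction)
  show "form_Q bar \<rho> (fraction M h r) (fraction M h r) = 0"
    using assms hr form_Q_eq[OF _ _ hr hr] by (simp add: Zero_fract_def eq_fract)
  have x1: "(x, 1) \<in> fraction M x 1" if "x \<in> carrier M" for x
    using that by (simp add: mem_fraction)
  show "\<forall>x\<in>carrier M. form_Q bar \<rho> (fraction M h r) (fraction M x 1) \<in> range to_fract"
    using assms form_Q_eq[OF _ _ hr x1] by (simp add: Fract_in_range_to_fract)
qed

context pointed_object
begin

lemma point_in_fractions: "point A \<in> fractions (fst A)"
  using pointed by (cases A) (simp add: pointed_skew_hermitian_def)

lemma point_memD:
  assumes "(h, r) \<in> point A"
  shows "h \<in> elems A" "r \<noteq> 0" "point A = fraction (fst A) h r"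
  using fractions_memD[OF point_in_fractions assms] by auto

lemma point_nonempty: "\<exists>h r. (h, r) \<in> point A"
  using point_in_fractions mem_fraction unfolding fractions_iff by fastforce

lemma point_mem_iff:
  assumes "(h, r) \<in> point A"
  shows "(k, t) \<in> point A \<longleftrightarrow> k \<in> elems A \<and> t \<noteq> 0 \<and> t \<odot>\<^bsub>fst A\<^esub> h = r \<odot>\<^bsub>fst A\<^esub> k"
  using point_memD[OF assms] mem_fraction by simp

lemma point_smult:
  assumes "(h, r) \<in> point A" "c \<noteq> 0"
  shows "(c \<odot>\<^bsub>fst A\<^esub> h, c * r) \<in> point A"
  unfolding point_mem_iff[OF assms(1)]
  using assms(2) point_memD(1,2)[OF assms(1)] by (simp add: smult_smult mult.commute)

lemma point_isotropic:
  assumes "(h, r) \<in> point A"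
  shows "form A h h = 0"
proof -
  have "form_Q bar (form A) (point A) (point A) = 0"
    using pointed by (cases A) (simp add: pointed_skew_hermitian_def)
  then have "Fract (form A h h) (r * bar r) = 0"
    using form_Q_eq[OF point_in_fractions point_in_fractions assms assms] by simp
  then show ?thesis using point_memD[OF assms] by (simp add: Zero_fract_def eq_fract)
qed

text \<open>The equation \<rho>(h/r, x) = \<rho>(h, x)/r with its denominator cleared. Since
  \<open>r\<close> is non-zero it determines the functional, and it replaces the definition from
  here on.\<close>

lemma from_point_eq:
  assumes "(h, r) \<in> point A" "x \<in> elems A"
  shows "r * from_point bar A x = form A h x"
proof -
  have "form_Q bar (form A) (point A) (fraction (fst A) x 1) = Fract (form A h x) r"
    using form_Q_eq[OF point_in_fractions _ assms(1), of "fraction (fst A) x 1" x 1] assms(2)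
    by (simp add: mem_fraction)
  moreover have "form_Q bar (form A) (point A) (fraction (fst A) x 1) \<in> range to_fract"
    using pointed assms(2) by (cases A) (simp add: pointed_skew_hermitian_def)
  ultimately show ?thesis
    using point_memD[OF assms(1)]
    by (auto simp: from_point_def Fract_in_range_to_fract the_inv_to_fract elim!: dvdE)
qed

text \<open>Only \<rho>(s, H) is integral by definition; integrality of \<rho>(H, s) comes from
  skew-symmetry, which exhibits the quotient as the negative conjugate of
  \<open>from_point bar A x\<close>.\<close>

lemma to_point_eq:
  assumes "(h, r) \<in> point A" "x \<in> elems A"
  shows "bar r * to_point bar A x = form A x h"
proof -
  have *: "form A x h = bar r * (- bar (from_point bar A x))"
    using form_skew[of x h] from_point_eq[OF assms, symmetric] point_memD[OF assms(1)] assms(2)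
    by simp
  have "form_Q bar (form A) (fraction (fst A) x 1) (point A) = Fract (form A x h) (bar r)"
    using form_Q_eq[OF _ point_in_fractions _ assms(1), of "fraction (fst A) x 1" x 1] assms(2)
    by (simp add: mem_fraction)
  then have "to_point bar A x = - bar (from_point bar A x)"
    using point_memD(2)[OF assms(1)] by (simp add: to_point_def the_inv_to_fract[OF _ *])
  then show ?thesis using * by simp
qed

lemma from_point_unique:
  assumes "(h, r) \<in> point A" "x \<in> elems A" "form A h x = r * c"
  shows "from_point bar A x = c"
  using from_point_eq[OF assms(1,2)] assms(3) point_memD[OF assms(1)] by simp

lemma to_point_unique:
  assumes "(h, r) \<in> point A" "x \<in> elems A" "form A x h = bar r * c"
  shows "to_point bar A x = c"
  using to_point_eq[OF assms(1,2)] assms(3) point_memD[OF assms(1)] by simp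

lemma to_point_eq_bar: "x \<in> elems A \<Longrightarrow> to_point bar A x = - bar (from_point bar A x)"
proof -
  assume x: "x \<in> elems A"
  obtain h r where hr: "(h, r) \<in> point A" using point_nonempty by blast
  show ?thesis
    using form_skew[of x h] from_point_eq[OF hr x, symmetric] point_memD[OF hr] x
    by (intro to_point_unique[OF hr x]) simp
qed

lemma from_point_add:
  assumes "x \<in> elems A" "y \<in> elems A"
  shows "from_point bar A (x \<oplus>\<^bsub>fst A\<^esub> y) = from_point bar A x + from_point bar A y"
proof -
  obtain h r where hr: "(h, r) \<in> point A" using point_nonempty by blast
  show ?thesis
    using assms point_memD[OF hr] hr
    by (intro from_point_unique[OF hr]) (auto simp: form_add_right from_point_eq distrib_left)
qed

lemma from_point_smult:
  assumes "x \<in> elems A"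
  shows "from_point bar A (a \<odot>\<^bsub>fst A\<^esub> x) = bar a * from_point bar A x"
proof -
  obtain h r where hr: "(h, r) \<in> point A" using point_nonempty by blast
  show ?thesis
    using assms point_memD[OF hr] from_point_eq[OF hr assms]
    by (intro from_point_unique[OF hr]) (auto simp: form_smult_right mult.left_commute)
qed

lemma to_point_add:
  assumes "x \<in> elems A" "y \<in> elems A"
  shows "to_point bar A (x \<oplus>\<^bsub>fst A\<^esub> y) = to_point bar A x + to_point bar A y"
  using assms by (simp add: to_point_eq_bar from_point_add)

lemma to_point_smult:
  assumes "x \<in> elems A"
  shows "to_point bar A (a \<odot>\<^bsub>fst A\<^esub> x) = a * to_point bar A x"
  using assms by (simp add: to_point_eq_bar from_point_smult)

lemma from_point_zero [simp]: "from_point bar A \<zero>\<^bsub>fst A\<^esub> = 0"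
proof -
  obtain h r where hr: "(h, r) \<in> point A" using point_nonempty by blast
  show ?thesis using point_memD[OF hr] by (intro from_point_unique[OF hr]) auto
qed

lemma to_point_zero [simp]: "to_point bar A \<zero>\<^bsub>fst A\<^esub> = 0"
  by (simp add: to_point_eq_bar)

lemma from_point_self: "(h, r) \<in> point A \<Longrightarrow> from_point bar A h = 0"
  using point_memD point_isotropic by (auto intro: from_point_unique)

lemma to_point_self: "(h, r) \<in> point A \<Longrightarrow> to_point bar A h = 0"
  using point_memD point_isotropic by (auto intro: to_point_unique)

end


section \<open>Lagrangian relations\<close>

text \<open>One factor \<open>q\<close> serves both components, and it is cancelled in each of them
  by torsion-freeness of that summand.\<close>

lemma fraction_module_sum:
  assumes "skew_hermitian_involution M bar \<rho>" "skew_hermitian_involution M' bar \<rho>'"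
    and "h \<in> carrier M" "h' \<in> carrier M'" "r \<noteq> 0"
  shows "fraction (module_sum M M') (h, h') r = fraction_pair (fraction M h r) (fraction M' h' r)"
proof -
  interpret M: skew_hermitian_involution M bar \<rho> by fact
  interpret M': skew_hermitian_involution M' bar \<rho>' by fact
  have "(\<exists>q. q \<noteq> 0 \<and> (q * t) \<odot>\<^bsub>M\<^esub> h = (q * r) \<odot>\<^bsub>M\<^esub> k \<and> (q * t) \<odot>\<^bsub>M'\<^esub> h' = (q * r) \<odot>\<^bsub>M'\<^esub> k') \<longleftrightarrow>
      t \<odot>\<^bsub>M\<^esub> h = r \<odot>\<^bsub>M\<^esub> k \<and> t \<odot>\<^bsub>M'\<^esub> h' = r \<odot>\<^bsub>M'\<^esub> k'" (is "?L \<longleftrightarrow> ?R")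
    if kk': "k \<in> carrier M" "k' \<in> carrier M'" for k k' t
  proof
    assume ?L
    then obtain q where q: "q \<noteq> 0" "q \<odot>\<^bsub>M\<^esub> (t \<odot>\<^bsub>M\<^esub> h) = q \<odot>\<^bsub>M\<^esub> (r \<odot>\<^bsub>M\<^esub> k)"
        "q \<odot>\<^bsub>M'\<^esub> (t \<odot>\<^bsub>M'\<^esub> h') = q \<odot>\<^bsub>M'\<^esub> (r \<odot>\<^bsub>M'\<^esub> k')"
      using assms kk' by (auto simp: M.smult_smult M'.smult_smult)
    show ?R
      using M.smult_cancel[OF q(1) _ _ q(2)] M'.smult_cancel[OF q(1) _ _ q(3)] assms that by simp
  next
    assume ?R then show ?L by (intro exI[of _ 1]) simp
  qed
  then show ?thesis
    using assms by (auto simp: fraction_pair_def M.mem_fraction M'.mem_fraction)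
      (auto simp: fraction_def fraction_rel_def)
qed

text \<open>The working form of the definition. The last conjunct spells out membership of the pair
  of points in N_Q: both are written over one denominator, with numerators related by
  \<open>N\<close>.\<close>

lemma lagrangian_relation_iff:
  assumes "pointed_object bar A" "pointed_object bar B"
  shows "lagrangian_relation A B N \<longleftrightarrow> N \<subseteq> elems A \<times> elems B \<and>
    (\<forall>x\<in>elems A. \<forall>y\<in>elems B. (x, y) \<in> N \<longleftrightarrow> (\<forall>(a, b)\<in>N. form A x a = form B y b)) \<and>
    (\<exists>a b r. (a, b) \<in> N \<and> (a, r) \<in> point A \<and> (b, r) \<in> point B)"
proof -
  interpret A: pointed_object bar A by fact
  interpret B: pointed_object bar B by fact
  let ?S = "module_sum (fst A) (fst B)"
  interpret S: module base_ring ?S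
    by (intro module_module_sum A.module_axioms B.module_axioms)
  define perp where "perp \<longleftrightarrow> N \<subseteq> elems A \<times> elems B \<and>
    (\<forall>x\<in>elems A. \<forall>y\<in>elems B. (x, y) \<in> N \<longleftrightarrow> (\<forall>(a, b)\<in>N. form A x a = form B y b))"
  have "N = annihilator ?S (diff_form (form A) (form B)) N \<longleftrightarrow> perp"
  proof -
    have *: "- p + q = 0 \<longleftrightarrow> p = q" for p q :: 'a by (auto simp: neg_eq_iff_add_eq_0)
    have ann: "(x, y) \<in> annihilator ?S (diff_form (form A) (form B)) N \<longleftrightarrow>
        x \<in> elems A \<and> y \<in> elems B \<and> (\<forall>(a, b)\<in>N. form A x a = form B y b)" for x y
      by (auto simp: annihilator_def diff_form_def *)
    show ?thesis
    proof
      assume N: "N = annihilator ?S (diff_form (form A) (form B)) N"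
      have "(x, y) \<in> N \<longleftrightarrow> x \<in> elems A \<and> y \<in> elems B \<and> (\<forall>(a, b)\<in>N. form A x a = form B y b)" for x y
        using arg_cong[OF N, of "\<lambda>V. (x, y) \<in> V"] unfolding ann .
      then show perp unfolding perp_def by (intro conjI subrelI ballI) simp_all
    next
      assume perp
      then have sub: "N \<subseteq> elems A \<times> elems B"
        and perp: "x \<in> elems A \<Longrightarrow> y \<in> elems B \<Longrightarrow>
          (x, y) \<in> N \<longleftrightarrow> (\<forall>(a, b)\<in>N. form A x a = form B y b)" for x y
        unfolding perp_def by blast+
      have "(x, y) \<in> N \<longleftrightarrow> (x, y) \<in> annihilator ?S (diff_form (form A) (form B)) N" for x y
        unfolding ann using sub perp[of x y] by blast
      then show "N = annihilator ?S (diff_form (form A) (form B)) N"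
        unfolding set_eq_iff split_paired_All by simp
    qed
  qed
  \<comment> \<open>An annihilator is a submodule because the forms are linear in the first
    variable.\<close>
  moreover have "submodule N base_ring ?S" if perp
  proof -
    have sub: "N \<subseteq> elems A \<times> elems B"
      and perp: "x \<in> elems A \<Longrightarrow> y \<in> elems B \<Longrightarrow> (x, y) \<in> N \<longleftrightarrow> (\<forall>(a, b)\<in>N. form A x a = form B y b)" for x y
      using that by (auto simp: perp_def)
    have subD: "a \<in> elems A" "b \<in> elems B" if "(a, b) \<in> N" for a b
      using that sub by auto
    have iso: "form A x a = form B y b" if "(x, y) \<in> N" "(a, b) \<in> N" for x y a b
      using that sub perp[of x y] by auto
    have smult: "a \<odot>\<^bsub>?S\<^esub> v \<in> N" if v: "v \<in> N" for a v
    proof -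
      obtain x y where v: "v = (x, y)" "(x, y) \<in> N" "x \<in> elems A" "y \<in> elems B"
        using v sub by (cases v) auto
      then show ?thesis
        using sub iso[OF v(2)] by (auto simp: perp A.form_smult_left B.form_smult_left)
    qed
    show ?thesis
    proof (rule S.submoduleI)
      show "N \<subseteq> carrier ?S" using sub by simp
      show "\<zero>\<^bsub>?S\<^esub> \<in> N" using sub by (auto simp: perp)
      show "a \<odot>\<^bsub>?S\<^esub> v \<in> N" if "v \<in> N" for a v using smult[OF that] .
      show "\<ominus>\<^bsub>?S\<^esub> v \<in> N" if "v \<in> N" for v
      proof -
        have "v \<in> carrier ?S" using that sub by auto
        then have "\<ominus>\<^bsub>?S\<^esub> v = (\<ominus>\<^bsub>base_ring\<^esub> 1) \<odot>\<^bsub>?S\<^esub> v"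
          using S.smult_l_minus[of 1 v] S.smult_one[of v] by simp
        then show ?thesis using smult[OF that] by simp
      qed
      show "v \<oplus>\<^bsub>?S\<^esub> w \<in> N" if vw: "v \<in> N" "w \<in> N" for v w
      proof -
        obtain x y x' y' where *: "v = (x, y)" "w = (x', y')" "(x, y) \<in> N" "(x', y') \<in> N"
            "x \<in> elems A" "y \<in> elems B" "x' \<in> elems A" "y' \<in> elems B"
          using vw sub by (cases v, cases w) auto
        have "form A (x \<oplus>\<^bsub>fst A\<^esub> x') a = form B (y \<oplus>\<^bsub>fst B\<^esub> y') b" if ab: "(a, b) \<in> N" for a b
          using * iso[OF *(3) ab] iso[OF *(4) ab] subD[OF ab]
          by (simp add: A.form_add_left B.form_add_left)
        then have "\<forall>(a, b)\<in>N. form A (x \<oplus>\<^bsub>fst A\<^esub> x') a = form B (y \<oplus>\<^bsub>fst B\<^esub> y') b"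
          by blast
        then show ?thesis using * by (simp add: perp)
      qed
    qed
  qed
  moreover have "fraction_pair (point A) (point B) \<in> fractions_of ?S N \<longleftrightarrow>
    (\<exists>a b r. (a, b) \<in> N \<and> (a, r) \<in> point A \<and> (b, r) \<in> point B)" (is "?L \<longleftrightarrow> ?R") if perp
  proof
    assume ?L
    then obtain a b r where abr: "(a, b) \<in> N" "r \<noteq> 0"
        "fraction_pair (point A) (point B) = fraction ?S (a, b) r"
      by (auto simp: fractions_of_def)
    then have "a \<in> elems A" "b \<in> elems B" using that by (auto simp: perp_def)
    then have "((a, b), r) \<in> fraction_pair (point A) (point B)"
      using abr fraction_module_sum[OF A.skew_hermitian_involution_axioms B.skew_hermitian_involution_axioms]
      by (simp add: fraction_pair_def A.mem_fraction B.mem_fraction)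
    then show ?R using abr(1) by (auto simp: fraction_pair_def)
  next
    assume ?R
    then obtain a b r where abr: "(a, b) \<in> N" "(a, r) \<in> point A" "(b, r) \<in> point B" by blast
    note A.point_memD[OF abr(2)] B.point_memD[OF abr(3)]
    then have "fraction_pair (point A) (point B) = fraction ?S (a, b) r"
      using fraction_module_sum[OF A.skew_hermitian_involution_axioms B.skew_hermitian_involution_axioms]
      by simp
    then show ?L using abr(1) \<open>r \<noteq> 0\<close> by (auto simp: fractions_of_def)
  qed
  ultimately show ?thesis
    unfolding lagrangian_relation_def lagrangian_def perp_def
    by (cases A; cases B) auto
qed

context skew_hermitian_involution
begin

definition generates :: "'u set \<Rightarrow> bool" where
  "generates S \<longleftrightarrow> finite S \<and> S \<subseteq> carrier M \<and> (\<forall>x\<in>carrier M. \<exists>c. x = (\<Oplus>y\<in>S. c y \<odot> y))"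

lemma generates_exists: "\<exists>S. generates S"
  using finitely_generated unfolding generates_def finitely_generated_def by blast

text \<open>Finitely many generators separate elements. This replaces conditions on a whole module
  by conditions over a finite index set, as the duality argument requires.\<close>

lemma generates_form_eqI:
  assumes "generates S" "u \<in> carrier M" "v \<in> carrier M" "\<And>y. y \<in> S \<Longrightarrow> \<rho> y u = \<rho> y v"
  shows "u = v"
proof (rule form_eqI_right[OF assms(2,3)])
  fix z assume "z \<in> carrier M"
  then obtain c where "z = (\<Oplus>y\<in>S. c y \<odot> y)" using assms(1) by (auto simp: generates_def)
  then show "\<rho> z u = \<rho> z v"
    using assms by (simp add: generates_def form_finsum_left cong: sum.cong)
qed

lemma generates_finsum_mem: "generates S \<Longrightarrow> (\<Oplus>y\<in>S. c y \<odot> y) \<in> carrier M"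
  by (rule finsum_closed) (auto simp: generates_def)

end

section \<open>Elementary properties of Lagrangian relations\<close>

locale pointed_lagrangian = A: pointed_object bar A + B: pointed_object bar B
  for bar :: "'a::idom \<Rightarrow> 'a" and A :: "('a, 'u) pointed_module" and B :: "('a, 'v) pointed_module" +
  fixes N :: "('u \<times> 'v) set"
  assumes lagrangian_relation: "lagrangian_relation A B N"
begin

lemmas iff = lagrangian_relation_iff[OF A.pointed_object_axioms B.pointed_object_axioms]

lemma memD: "(x, y) \<in> N \<Longrightarrow> x \<in> elems A" "(x, y) \<in> N \<Longrightarrow> y \<in> elems B"
  using lagrangian_relation unfolding iff by auto

lemma memI:
  assumes "x \<in> elems A" "y \<in> elems B" "\<And>a b. (a, b) \<in> N \<Longrightarrow> form A x a = form B y b"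
  shows "(x, y) \<in> N"
  using lagrangian_relation assms unfolding iff by auto

lemma form_eq: "(x, y) \<in> N \<Longrightarrow> (a, b) \<in> N \<Longrightarrow> form A x a = form B y b"
  using lagrangian_relation memD[of x y] unfolding iff by auto

lemma point_rep: "\<exists>a b r. (a, b) \<in> N \<and> (a, r) \<in> point A \<and> (b, r) \<in> point B"
  using lagrangian_relation unfolding iff by auto

lemma zero: "(\<zero>\<^bsub>fst A\<^esub>, \<zero>\<^bsub>fst B\<^esub>) \<in> N"
  by (rule memI) (auto simp: memD)

lemma smult: "(x, y) \<in> N \<Longrightarrow> (a \<odot>\<^bsub>fst A\<^esub> x, a \<odot>\<^bsub>fst B\<^esub> y) \<in> N"
  by (rule memI) (auto simp: memD A.form_smult_left B.form_smult_left form_eq)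

lemma add: "(x, y) \<in> N \<Longrightarrow> (x', y') \<in> N \<Longrightarrow> (x \<oplus>\<^bsub>fst A\<^esub> x', y \<oplus>\<^bsub>fst B\<^esub> y') \<in> N"
  by (rule memI) (auto simp: memD A.form_add_left B.form_add_left form_eq)

text \<open>A Lagrangian is its own closure: its defining equations take values in a domain, so a
  non-zero factor can be divided out.\<close>

lemma smult_memD:
  assumes "r \<noteq> 0" "(r \<odot>\<^bsub>fst A\<^esub> x, r \<odot>\<^bsub>fst B\<^esub> y) \<in> N" "x \<in> elems A" "y \<in> elems B"
  shows "(x, y) \<in> N"
proof (rule memI[OF assms(3,4)])
  fix a b assume "(a, b) \<in> N"
  then show "form A x a = form B y b"
    using form_eq[OF assms(2)] assms memD
    by (metis A.form_smult_left B.form_smult_left mult_left_cancel)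
qed

text \<open>Isotropy of \<open>N\<close>, applied to \<open>(x, y)\<close> and to numerators of the
  two points over a common denominator.\<close>

lemma from_point_eq: "(x, y) \<in> N \<Longrightarrow> from_point bar A x = from_point bar B y"
proof -
  assume xy: "(x, y) \<in> N"
  obtain a b r where ab: "(a, b) \<in> N" "(a, r) \<in> point A" "(b, r) \<in> point B"
    using point_rep by blast
  show ?thesis
    using form_eq[OF ab(1) xy] memD[OF xy] B.from_point_eq[OF ab(3)]
    by (intro A.from_point_unique[OF ab(2)]) auto
qed

lemma to_point_eq: "(x, y) \<in> N \<Longrightarrow> to_point bar A x = to_point bar B y"
  by (simp add: A.to_point_eq_bar B.to_point_eq_bar memD from_point_eq)

end

section \<open>Closed composition of Lagrangian relations\<close>

definition lagrangian_comp ::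
  "('a::idom, 'u) pointed_module \<Rightarrow> ('a, 'v) pointed_module \<Rightarrow> ('a, 'w) pointed_module \<Rightarrow>
    ('u \<times> 'v) set \<Rightarrow> ('v \<times> 'w) set \<Rightarrow> ('u \<times> 'w) set" where
  "lagrangian_comp A B C N1 N2 = closure_in (module_sum (fst A) (fst C))
    {(h1, h3). \<exists>h2 \<in> elems B. (h1, h2) \<in> N1 \<and> (h2, h3) \<in> N2}"

lemma mem_lagrangian_comp:
  "(x, z) \<in> lagrangian_comp A B C N1 N2 \<longleftrightarrow> x \<in> elems A \<and> z \<in> elems C \<and>
    (\<exists>r y. r \<noteq> 0 \<and> y \<in> elems B \<and> (r \<odot>\<^bsub>fst A\<^esub> x, y) \<in> N1 \<and> (y, r \<odot>\<^bsub>fst C\<^esub> z) \<in> N2)"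
  by (auto simp: lagrangian_comp_def closure_in_def)

locale composable_lagrangians =
  N1: pointed_lagrangian bar A B N1 + N2: pointed_lagrangian bar B C N2
  for bar :: "'a::idom \<Rightarrow> 'a" and A :: "('a, 'u) pointed_module" and B :: "('a, 'v) pointed_module"
    and C :: "('a, 'w) pointed_module" and N1 N2
begin

text \<open>
  The functional \<open>(a, b, c) \<mapsto> \<rho>(a, x) - \<tau>(c, z)\<close> vanishes on all \<open>(a, b, c)\<close> with \<open>(a, b) \<in> N1\<close>
  and \<open>(b, c) \<in> N2\<close>, which is the common kernel of the functionals \<open>\<phi> p q q' w\<close> with \<open>(p, q) \<in> N1\<close>
  and \<open>(q', w) \<in> N2\<close>. If a multiple of it equals one of these, then \<open>q = q'\<close> is the required \<open>y\<close>.
\<close>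

lemma perp_comp:
  assumes "x \<in> elems A" "z \<in> elems C"
    and perp: "\<And>a b c. (a, b) \<in> N1 \<Longrightarrow> (b, c) \<in> N2 \<Longrightarrow> form A x a = form C z c"
  shows "\<exists>r y. r \<noteq> 0 \<and> (r \<odot>\<^bsub>fst A\<^esub> x, y) \<in> N1 \<and> (y, r \<odot>\<^bsub>fst C\<^esub> z) \<in> N2"
proof -
  obtain S1 S2 S3 where gen: "N1.A.generates S1" "N1.B.generates S2" "N2.B.generates S3"
    using N1.A.generates_exists N1.B.generates_exists N2.B.generates_exists by blast
  define \<phi> where "\<phi> p q q' w = (\<lambda>i. case i of Inl a \<Rightarrow> form A a p
    | Inr (Inl b) \<Rightarrow> form B b q' - form B b q | Inr (Inr c) \<Rightarrow> - form C c w)" for p q q' w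
  define F where "F = {\<phi> p q q' w | p q q' w. (p, q) \<in> N1 \<and> (q', w) \<in> N2}"
  \<comment> \<open>A coefficient vector \<open>u\<close> on the disjoint union of the three
    generating sets stands for the triple \<open>(lcA u, lcB u, lcC u)\<close>; these vectors are
    the test vectors of \<open>functional_combination\<close>.\<close>
  define lcA where "lcA u = (\<Oplus>\<^bsub>fst A\<^esub>y\<in>S1. u (Inl y) \<odot>\<^bsub>fst A\<^esub> y)" for u :: "'u + 'v + 'w \<Rightarrow> 'a"
  define lcB where "lcB u = (\<Oplus>\<^bsub>fst B\<^esub>y\<in>S2. u (Inr (Inl y)) \<odot>\<^bsub>fst B\<^esub> y)" for u :: "'u + 'v + 'w \<Rightarrow> 'a"
  define lcC where "lcC u = (\<Oplus>\<^bsub>fst C\<^esub>y\<in>S3. u (Inr (Inr y)) \<odot>\<^bsub>fst C\<^esub> y)" for u :: "'u + 'v + 'w \<Rightarrow> 'a"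
  note fin = gen[unfolded N1.A.generates_def N1.B.generates_def N2.B.generates_def]
  have lc: "lcA u \<in> elems A" "lcB u \<in> elems B" "lcC u \<in> elems C" for u
    unfolding lcA_def lcB_def lcC_def
    using gen N1.A.generates_finsum_mem N1.B.generates_finsum_mem N2.B.generates_finsum_mem by auto
  have sum: "(\<Sum>i\<in>S1 <+> S2 <+> S3. u i * \<phi> p q q' w i) =
      form A (lcA u) p + (form B (lcB u) q' - form B (lcB u) q) - form C (lcC u) w"
    if "p \<in> elems A" "q \<in> elems B" "q' \<in> elems B" "w \<in> elems C" for u p q q' w
    using fin that
    by (simp add: sum.Plus \<phi>_def lcA_def lcB_def lcC_def N1.A.form_finsum_left
        N1.B.form_finsum_left N2.B.form_finsum_left right_diff_distrib sum_subtractf sum_negf)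
  have on_gen: "y \<in> S1 \<Longrightarrow> y \<in> elems A" "y' \<in> S2 \<Longrightarrow> y' \<in> elems B" "y'' \<in> S3 \<Longrightarrow> y'' \<in> elems C" for y y' y''
    using fin by auto
  let ?T = "S1 <+> S2 <+> S3" and ?g = "\<phi> x \<zero>\<^bsub>fst B\<^esub> \<zero>\<^bsub>fst B\<^esub> z"
  \<comment> \<open>The family \<open>F\<close> is closed under sums and multiples only as far as
    values on generators go, because the forms are arbitrary off the carriers. Hence it is saturated
    under agreement on \<open>?T\<close>.\<close>
  define F' where "F' = {f. \<exists>f0\<in>F. \<forall>i\<in>?T. f i = f0 i}"
  have \<phi>_mem: "\<phi> p q q' w \<in> F'" if "(p, q) \<in> N1" "(q', w) \<in> N2" for p q q' w
    unfolding F'_def F_def using that by blast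
  have "\<exists>r f. r \<noteq> 0 \<and> f \<in> F' \<and> (\<forall>i\<in>?T. r * ?g i = f i)"
  proof (rule functional_combination)
    show "finite ?T" using fin by simp
    show "F' \<noteq> {}" using \<phi>_mem[OF N1.zero N2.zero] by blast
  next
    fix f f' assume "f \<in> F'" "f' \<in> F'"
    then obtain p q q' w where f: "\<forall>i\<in>?T. f i = \<phi> p q q' w i" "(p, q) \<in> N1" "(q', w) \<in> N2"
      by (auto simp: F'_def F_def)
    from \<open>f' \<in> F'\<close> obtain p2 q2 q2' w2
      where f': "\<forall>i\<in>?T. f' i = \<phi> p2 q2 q2' w2 i" "(p2, q2) \<in> N1" "(q2', w2) \<in> N2"
      by (auto simp: F'_def F_def)
    have "f i + f' i = \<phi> (p \<oplus>\<^bsub>fst A\<^esub> p2) (q \<oplus>\<^bsub>fst B\<^esub> q2) (q' \<oplus>\<^bsub>fst B\<^esub> q2') (w \<oplus>\<^bsub>fst C\<^esub> w2) i"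
      if "i \<in> ?T" for i
      using that f f' N1.memD[OF f(2)] N1.memD[OF f'(2)] N2.memD[OF f(3)] N2.memD[OF f'(3)]
      by (auto simp: \<phi>_def on_gen N1.A.form_add_right N1.B.form_add_right N2.B.form_add_right)
    then show "(\<lambda>i. f i + f' i) \<in> F'"
      using N1.add[OF f(2) f'(2)] N2.add[OF f(3) f'(3)] unfolding F'_def F_def by blast
  next
    fix f c assume "f \<in> F'"
    then obtain p q q' w where f: "\<forall>i\<in>?T. f i = \<phi> p q q' w i" "(p, q) \<in> N1" "(q', w) \<in> N2"
      by (auto simp: F'_def F_def)
    \<comment> \<open>The parameters sit in the second, conjugate-linear slot, so the functional is
      scaled by \<open>c\<close> when they are scaled by \<open>bar c\<close>.\<close>
    have "c * f i = \<phi> (bar c \<odot>\<^bsub>fst A\<^esub> p) (bar c \<odot>\<^bsub>fst B\<^esub> q) (bar c \<odot>\<^bsub>fst B\<^esub> q') (bar c \<odot>\<^bsub>fst C\<^esub> w) i"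
      if "i \<in> ?T" for i
      using that f N1.memD[OF f(2)] N2.memD[OF f(3)]
      by (auto simp: \<phi>_def on_gen N1.A.form_smult_right N1.B.form_smult_right N2.B.form_smult_right
          right_diff_distrib)
    then show "(\<lambda>i. c * f i) \<in> F'"
      using N1.smult[OF f(2)] N2.smult[OF f(3)] unfolding F'_def F_def by blast
  next
    fix u assume vanish: "\<forall>f\<in>F'. (\<Sum>i\<in>?T. u i * f i) = 0"
    have u: "form A (lcA u) p + (form B (lcB u) q' - form B (lcB u) q) - form C (lcC u) w = 0"
      if "(p, q) \<in> N1" "(q', w) \<in> N2" for p q q' w
      using sum[of p q q' w u] N1.memD[OF that(1)] N2.memD[OF that(2)] bspec[OF vanish \<phi>_mem[OF that]]
      by simp
    \<comment> \<open>Setting the parameters from \<open>N2\<close> to zero isolates the equations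
      for \<open>N1\<close>, and conversely; maximality then puts both pairs into the
      relations.\<close>
    have 1: "(lcA u, lcB u) \<in> N1" using u[OF _ N2.zero] lc by (intro N1.memI) auto
    have 2: "(lcB u, lcC u) \<in> N2" using u[OF N1.zero] lc by (intro N2.memI) auto
    \<comment> \<open>The hypothesis has \<open>x\<close> and \<open>z\<close> on the left, the
      functionals have them on the right; skew-symmetry exchanges the slots.\<close>
    have "form A (lcA u) x = form C (lcC u) z"
      using perp[OF 1 2] N1.A.form_skew[OF lc(1) assms(1)] N2.B.form_skew[OF lc(3) assms(2)] by simp
    then show "(\<Sum>i\<in>?T. u i * ?g i) = 0"
      using sum[OF assms(1) _ _ assms(2), of "\<zero>\<^bsub>fst B\<^esub>" "\<zero>\<^bsub>fst B\<^esub>" u] by simp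
  qed
  then obtain r p q q' w where r: "r \<noteq> 0" and pq: "(p, q) \<in> N1" "(q', w) \<in> N2"
      and eq: "\<forall>i\<in>?T. r * ?g i = \<phi> p q q' w i"
    unfolding F'_def F_def by auto
  note mem = N1.memD[OF pq(1)] N2.memD[OF pq(2)]
  have eqA: "r * form A y x = form A y p" if "y \<in> S1" for y
    using bspec[OF eq InlI[OF that]] by (simp add: \<phi>_def)
  have eqB: "form B y q = form B y q'" if "y \<in> S2" for y
    using bspec[OF eq InrI[OF InlI[OF that]]] by (simp add: \<phi>_def)
  have eqC: "r * form C y z = form C y w" if "y \<in> S3" for y
    using bspec[OF eq InrI[OF InrI[OF that]]] by (simp add: \<phi>_def)
  \<comment> \<open>The factor \<open>r\<close> in front of the form moves into the second slot as
    \<open>bar r\<close>, which is therefore the multiplier to be exhibited.\<close>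
  have "bar r \<odot>\<^bsub>fst A\<^esub> x = p"
    using mem assms(1) on_gen(1)
    by (intro N1.A.generates_form_eqI[OF gen(1)]) (simp_all add: N1.A.form_smult_right eqA)
  moreover have "q = q'"
    using mem by (intro N1.B.generates_form_eqI[OF gen(2)]) (simp_all add: eqB)
  moreover have "bar r \<odot>\<^bsub>fst C\<^esub> z = w"
    using mem assms(2) on_gen(3)
    by (intro N2.B.generates_form_eqI[OF gen(3)]) (simp_all add: N2.B.form_smult_right eqC)
  ultimately show ?thesis using pq r by (intro exI[of _ "bar r"] exI[of _ q]) auto
qed

lemma compI:
  assumes "(x, y) \<in> N1" "(y, z) \<in> N2"
  shows "(x, z) \<in> lagrangian_comp A B C N1 N2"
  unfolding mem_lagrangian_comp
  using N1.memD[OF assms(1)] N2.memD[OF assms(2)] assms by (auto intro!: exI[of _ 1])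

text \<open>Isotropy is passed on through the middle module after multiplying both pairs into the
  unclosed composite; maximality is \<open>perp_comp\<close>.\<close>

lemma lagrangian_relation_comp:
  "lagrangian_relation A C (lagrangian_comp A B C N1 N2)" (is "lagrangian_relation _ _ ?N")
  unfolding lagrangian_relation_iff[OF N1.A.pointed_object_axioms N2.B.pointed_object_axioms]
proof (intro conjI ballI)
  show "?N \<subseteq> elems A \<times> elems C" by (auto simp: mem_lagrangian_comp)
next
  fix x z assume xz: "x \<in> elems A" "z \<in> elems C"
  have "form A x a = form C z c" if mem: "(x, z) \<in> ?N" "(a, c) \<in> ?N" for a c
  proof -
    obtain r y where *: "r \<noteq> 0" "(r \<odot>\<^bsub>fst A\<^esub> x, y) \<in> N1" "(y, r \<odot>\<^bsub>fst C\<^esub> z) \<in> N2"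
      using mem(1) by (auto simp: mem_lagrangian_comp)
    obtain r' y' where mem': "r' \<noteq> 0" "(r' \<odot>\<^bsub>fst A\<^esub> a, y') \<in> N1"
        "(y', r' \<odot>\<^bsub>fst C\<^esub> c) \<in> N2" "a \<in> elems A" "c \<in> elems C"
      using mem(2) by (auto simp: mem_lagrangian_comp)
    have "form A (r \<odot>\<^bsub>fst A\<^esub> x) (r' \<odot>\<^bsub>fst A\<^esub> a) = form C (r \<odot>\<^bsub>fst C\<^esub> z) (r' \<odot>\<^bsub>fst C\<^esub> c)"
      using N1.form_eq[OF *(2) mem'(2)] N2.form_eq[OF *(3) mem'(3)] by simp
    then show ?thesis
      using * mem' xz by (simp add: N1.A.form_smult_left N1.A.form_smult_right
          N2.B.form_smult_left N2.B.form_smult_right)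
  qed
  moreover have "(x, z) \<in> ?N" if "\<forall>(a, c)\<in>?N. form A x a = form C z c"
  proof -
    have "form A x a = form C z c" if "(a, b) \<in> N1" "(b, c) \<in> N2" for a b c
    proof -
      show ?thesis using compI[OF that] \<open>\<forall>(a, c)\<in>?N. _\<close> by blast
    qed
    from perp_comp[OF xz this] show ?thesis
      unfolding mem_lagrangian_comp using xz N1.memD(2) by fast
  qed
  ultimately show "(x, z) \<in> ?N \<longleftrightarrow> (\<forall>(a, c)\<in>?N. form A x a = form C z c)" by blast
next
  obtain a b r where ab: "(a, b) \<in> N1" "(a, r) \<in> point A" "(b, r) \<in> point B"
    using N1.point_rep by blast
  obtain b' c r' where bc: "(b', c) \<in> N2" "(b', r') \<in> point B" "(c, r') \<in> point C"
    using N2.point_rep by blast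
  have nz: "r \<noteq> 0" "r' \<noteq> 0" using N1.A.point_memD[OF ab(2)] N1.B.point_memD[OF bc(2)] by auto
  \<comment> \<open>The two relations represent the middle point by possibly different fractions b/r
    and b'/r'. Cross-multiplied numerators coincide, so suitable multiples of the two pairs can be
    composed.\<close>
  have "r' \<odot>\<^bsub>fst B\<^esub> b = r \<odot>\<^bsub>fst B\<^esub> b'" using bc(2) N1.B.point_mem_iff[OF ab(3)] by blast
  then have N12: "(r' \<odot>\<^bsub>fst A\<^esub> a, r \<odot>\<^bsub>fst B\<^esub> b') \<in> N1" "(r \<odot>\<^bsub>fst B\<^esub> b', r \<odot>\<^bsub>fst C\<^esub> c) \<in> N2"
    using N1.smult[OF ab(1), of r'] N2.smult[OF bc(1), of r] by auto
  have "(r' \<odot>\<^bsub>fst A\<^esub> a, r \<odot>\<^bsub>fst C\<^esub> c) \<in> ?N"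
    using compI[OF N12] .
  moreover have "(r' \<odot>\<^bsub>fst A\<^esub> a, r * r') \<in> point A" "(r \<odot>\<^bsub>fst C\<^esub> c, r * r') \<in> point C"
    using N1.A.point_smult[OF ab(2) nz(2)] N2.B.point_smult[OF bc(3) nz(1)]
    by (simp_all add: mult.commute)
  ultimately show "\<exists>a c r. (a, c) \<in> ?N \<and> (a, r) \<in> point A \<and> (c, r) \<in> point C"
    by blast
qed

lemma pointed_lagrangian_comp: "pointed_lagrangian bar A C (lagrangian_comp A B C N1 N2)"
  using lagrangian_relation_comp by unfold_locales

end

section \<open>Isometries and their graphs\<close>

definition isometry ::
  "('a::idom, 'u) pointed_module \<Rightarrow> ('a, 'v) pointed_module \<Rightarrow> ('u \<Rightarrow> 'v) \<Rightarrow> bool" where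
  "isometry A B \<phi> \<longleftrightarrow> bij_betw \<phi> (elems A) (elems B) \<and>
    (\<forall>x\<in>elems A. \<forall>y\<in>elems A. form B (\<phi> x) (\<phi> y) = form A x y) \<and>
    (\<exists>h r. (h, r) \<in> point A \<and> (\<phi> h, r) \<in> point B)"

lemma isometryD:
  assumes "isometry A B \<phi>"
  shows "x \<in> elems A \<Longrightarrow> \<phi> x \<in> elems B"
    "x \<in> elems A \<Longrightarrow> y \<in> elems A \<Longrightarrow> form B (\<phi> x) (\<phi> y) = form A x y"
    "z \<in> elems B \<Longrightarrow> \<exists>x\<in>elems A. z = \<phi> x"
    "\<exists>h r. (h, r) \<in> point A \<and> (\<phi> h, r) \<in> point B"
    "inj_on \<phi> (elems A)"
  using assms by (auto simp: isometry_def bij_betw_def)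

lemma isometry_inv_into:
  assumes "isometry A B \<phi>" "point A \<subseteq> elems A \<times> UNIV"
  shows "isometry B A (inv_into (elems A) \<phi>)"
proof -
  note * = isometryD[OF assms(1)]
  have "bij_betw \<phi> (elems A) (elems B)" using assms(1) by (simp add: isometry_def)
  then have "bij_betw (inv_into (elems A) \<phi>) (elems B) (elems A)" by (rule bij_betw_inv_into)
  moreover have right: "\<phi> (inv_into (elems A) \<phi> x) = x" "inv_into (elems A) \<phi> x \<in> elems A"
    if "x \<in> elems B" for x
    using \<open>bij_betw \<phi> _ _\<close> that by (auto simp: bij_betw_def f_inv_into_f inv_into_into)
  moreover have "form A (inv_into (elems A) \<phi> x) (inv_into (elems A) \<phi> y) = form B x y"
    if "x \<in> elems B" "y \<in> elems B" for x y
    using *(2)[OF right(2)[OF that(1)] right(2)[OF that(2)]] that by (simp add: right(1))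
  moreover have "\<exists>h r. (h, r) \<in> point B \<and> (inv_into (elems A) \<phi> h, r) \<in> point A"
  proof -
    obtain h r where hr: "(h, r) \<in> point A" "(\<phi> h, r) \<in> point B" using *(4) by blast
    then have "inv_into (elems A) \<phi> (\<phi> h) = h" using assms(2) *(5) by (auto intro: inv_into_f_f)
    then show ?thesis using hr by (intro exI[of _ "\<phi> h"] exI[of _ r]) simp
  qed
  ultimately show ?thesis by (simp add: isometry_def)
qed

text \<open>Linearity is automatic, because the forms are non-degenerate.\<close>

lemma isometry_smult:
  assumes "pointed_object bar A" "pointed_object bar B" "isometry A B \<phi>" "x \<in> elems A"
  shows "\<phi> (a \<odot>\<^bsub>fst A\<^esub> x) = a \<odot>\<^bsub>fst B\<^esub> \<phi> x"
proof -
  interpret A: pointed_object bar A by fact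
  interpret B: pointed_object bar B by fact
  note * = isometryD[OF assms(3)]
  show ?thesis
  proof (rule B.form_eqI)
    fix z assume "z \<in> elems B"
    then obtain w where "w \<in> elems A" "z = \<phi> w" using *(3) by blast
    then show "form B (\<phi> (a \<odot>\<^bsub>fst A\<^esub> x)) z = form B (a \<odot>\<^bsub>fst B\<^esub> \<phi> x) z"
      using assms(4) by (simp add: *(1,2) A.form_smult_left B.form_smult_left)
  qed (use assms(4) *(1) in auto)
qed

text \<open>By surjectivity every pair is \<open>(x, \<phi> u)\<close>. It annihilates the graph iff
  \<rho>(x, .) = \<rho>(u, .), that is, by non-degeneracy, iff x = u.\<close>

lemma isometry_graph:
  assumes "pointed_object bar A" "pointed_object bar B" "isometry A B \<phi>"
  shows "pointed_lagrangian bar A B {(x, \<phi> x) | x. x \<in> elems A}"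
proof -
  interpret A: pointed_object bar A by fact
  interpret B: pointed_object bar B by fact
  note * = isometryD[OF assms(3)]
  have "lagrangian_relation A B {(x, \<phi> x) | x. x \<in> elems A}"
    unfolding lagrangian_relation_iff[OF assms(1,2)]
  proof (intro conjI ballI)
    fix x y assume xy: "x \<in> elems A" "y \<in> elems B"
    then obtain u where u: "u \<in> elems A" "y = \<phi> u" using *(3) by blast
    have "(x, y) \<in> {(x, \<phi> x) | x. x \<in> elems A} \<longleftrightarrow> x = u"
      using u xy inj_onD[OF *(5)] by auto
    also have "\<dots> \<longleftrightarrow> (\<forall>a\<in>elems A. form A x a = form A u a)"
      using A.form_eqI[OF xy(1) u(1)] by auto
    also have "\<dots> \<longleftrightarrow> (\<forall>(a, b)\<in>{(x, \<phi> x) | x. x \<in> elems A}. form A x a = form B y b)"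
      using u by (auto simp: *(2))
    finally show "(x, y) \<in> {(x, \<phi> x) | x. x \<in> elems A} \<longleftrightarrow>
        (\<forall>(a, b)\<in>{(x, \<phi> x) | x. x \<in> elems A}. form A x a = form B y b)" .
  next
    show "\<exists>a b r. (a, b) \<in> {(x, \<phi> x) | x. x \<in> elems A} \<and> (a, r) \<in> point A \<and> (b, r) \<in> point B"
      using *(4) A.point_memD(1) by blast
  qed (use *(1) in auto)
  then show ?thesis by unfold_locales
qed

text \<open>If r(x, z) lies in the unclosed composite, then r(\<phi> x, z) lies in \<open>N\<close>
  by linearity of \<open>\<phi>\<close>, and \<open>N\<close> is its own closure.\<close>

lemma comp_isometry_left:
  assumes "pointed_object bar A" "isometry A B \<phi>" "pointed_lagrangian bar B C N"
  shows "lagrangian_comp A B C {(x, \<phi> x) | x. x \<in> elems A} N = {(x, z). x \<in> elems A \<and> (\<phi> x, z) \<in> N}"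
proof -
  interpret N: pointed_lagrangian bar B C N by fact
  interpret A: pointed_object bar A by fact
  have "(x, z) \<in> lagrangian_comp A B C {(x, \<phi> x) | x. x \<in> elems A} N \<longleftrightarrow>
      x \<in> elems A \<and> (\<phi> x, z) \<in> N" for x z
    unfolding mem_lagrangian_comp
    using isometryD(1)[OF assms(2)] isometry_smult[OF assms(1) N.A.pointed_object_axioms assms(2)]
      N.memD[of "\<phi> x" z] N.smult_memD[of _ "\<phi> x" z]
    by (auto intro!: exI[of _ 1])
  then show ?thesis by auto
qed

lemma comp_isometry_right:
  assumes "pointed_object bar C" "isometry B C \<phi>" "pointed_lagrangian bar A B N"
  shows "lagrangian_comp A B C N {(y, \<phi> y) | y. y \<in> elems B} = {(x, \<phi> y) | x y. (x, y) \<in> N}"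
proof -
  interpret N: pointed_lagrangian bar A B N by fact
  interpret C: pointed_object bar C by fact
  note * = isometryD[OF assms(2)]
  note smult = isometry_smult[OF N.B.pointed_object_axioms assms(1,2)]
  have "(x, z) \<in> lagrangian_comp A B C N {(y, \<phi> y) | y. y \<in> elems B} \<longleftrightarrow>
      (\<exists>y. (x, y) \<in> N \<and> z = \<phi> y)" (is "?L \<longleftrightarrow> ?R") for x z
  proof
    assume ?L
    then obtain r y where ry: "r \<noteq> 0" "(r \<odot>\<^bsub>fst A\<^esub> x, y) \<in> N" "r \<odot>\<^bsub>fst C\<^esub> z = \<phi> y"
        "x \<in> elems A" "z \<in> elems C" "y \<in> elems B"
      by (auto simp: mem_lagrangian_comp)
    then obtain u where u: "u \<in> elems B" "z = \<phi> u" using *(3) by blast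
    \<comment> \<open>Here the multiplier appears on the target side, and injectivity of
      \<open>\<phi>\<close> brings it back to \<open>B\<close>, where closedness of \<open>N\<close>
      applies.\<close>
    have "r \<odot>\<^bsub>fst B\<^esub> u = y"
      using ry u smult[of u r] *(5) by (auto dest: inj_onD)
    then show ?R using N.smult_memD[of r x u] ry u by blast
  next
    assume ?R
    then obtain y where "(x, y) \<in> N" "z = \<phi> y" by blast
    then show ?L
      unfolding mem_lagrangian_comp using N.memD[of x y] *(1)[of y]
      by (intro conjI exI[of _ 1] exI[of _ y]) auto
  qed
  then show ?thesis by auto
qed

lemma isometry_id: "pointed_object bar A \<Longrightarrow> isometry A A (\<lambda>x. x)"
  using pointed_object.point_nonempty by (fastforce simp: isometry_def bij_betw_def)

text \<open>Both bracketings are the closure of the threefold set-theoretic composite, described by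
  \<open>?P\<close>. Nested closures merge, as two successive multipliers can be replaced by their
  product.\<close>

lemma lagrangian_comp_assoc:
  assumes "pointed_lagrangian bar A B N1" "pointed_lagrangian bar B C N2" "pointed_lagrangian bar C D N3"
  shows "lagrangian_comp A B D N1 (lagrangian_comp B C D N2 N3) =
    lagrangian_comp A C D (lagrangian_comp A B C N1 N2) N3"
proof -
  interpret N1: pointed_lagrangian bar A B N1 by fact
  interpret N2: pointed_lagrangian bar B C N2 by fact
  interpret N3: pointed_lagrangian bar C D N3 by fact
  interpret N12: composable_lagrangians bar A B C N1 N2 ..
  interpret N23: composable_lagrangians bar B C D N2 N3 ..
  let ?P = "\<lambda>x w. x \<in> elems A \<and> w \<in> elems D \<and> (\<exists>r y z. r \<noteq> 0 \<and>
    (r \<odot>\<^bsub>fst A\<^esub> x, y) \<in> N1 \<and> (y, z) \<in> N2 \<and> (z, r \<odot>\<^bsub>fst D\<^esub> w) \<in> N3)"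
  have 1: "(x, w) \<in> lagrangian_comp A B D N1 (lagrangian_comp B C D N2 N3) \<longleftrightarrow> ?P x w" for x w
  proof
    assume "(x, w) \<in> lagrangian_comp A B D N1 (lagrangian_comp B C D N2 N3)"
    then obtain r y s z where *: "x \<in> elems A" "w \<in> elems D" "r \<noteq> 0" "(r \<odot>\<^bsub>fst A\<^esub> x, y) \<in> N1"
        "s \<noteq> 0" "(s \<odot>\<^bsub>fst B\<^esub> y, z) \<in> N2" "(z, s \<odot>\<^bsub>fst D\<^esub> (r \<odot>\<^bsub>fst D\<^esub> w)) \<in> N3"
      by (auto simp: mem_lagrangian_comp)
    then show "?P x w"
      using N1.smult[OF *(4), of s]
      by (auto simp: N1.A.smult_smult N3.B.smult_smult
          intro!: exI[of _ "s * r"] exI[of _ "s \<odot>\<^bsub>fst B\<^esub> y"] exI[of _ z])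
  next
    assume "?P x w"
    then obtain r y z where *: "x \<in> elems A" "w \<in> elems D" "r \<noteq> 0"
        "(r \<odot>\<^bsub>fst A\<^esub> x, y) \<in> N1" "(y, z) \<in> N2" "(z, r \<odot>\<^bsub>fst D\<^esub> w) \<in> N3"
      by blast
    show "(x, w) \<in> lagrangian_comp A B D N1 (lagrangian_comp B C D N2 N3)"
      unfolding mem_lagrangian_comp[of x w]
      using * N23.compI[OF *(5,6)] N1.memD(2)[OF *(4)] by (intro conjI exI[of _ r] exI[of _ y])
  qed
  have 2: "(x, w) \<in> lagrangian_comp A C D (lagrangian_comp A B C N1 N2) N3 \<longleftrightarrow> ?P x w" for x w
  proof
    assume "(x, w) \<in> lagrangian_comp A C D (lagrangian_comp A B C N1 N2) N3"
    then obtain r y s z where *: "x \<in> elems A" "w \<in> elems D" "r \<noteq> 0" "(z, r \<odot>\<^bsub>fst D\<^esub> w) \<in> N3"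
        "s \<noteq> 0" "(y, s \<odot>\<^bsub>fst C\<^esub> z) \<in> N2" "(s \<odot>\<^bsub>fst A\<^esub> (r \<odot>\<^bsub>fst A\<^esub> x), y) \<in> N1"
      by (auto simp: mem_lagrangian_comp)
    then show "?P x w"
      using N3.smult[OF *(4), of s]
      by (auto simp: N1.A.smult_smult N3.B.smult_smult
          intro!: exI[of _ "s * r"] exI[of _ y] exI[of _ "s \<odot>\<^bsub>fst C\<^esub> z"])
  next
    assume "?P x w"
    then obtain r y z where *: "x \<in> elems A" "w \<in> elems D" "r \<noteq> 0"
        "(r \<odot>\<^bsub>fst A\<^esub> x, y) \<in> N1" "(y, z) \<in> N2" "(z, r \<odot>\<^bsub>fst D\<^esub> w) \<in> N3"
      by blast
    show "(x, w) \<in> lagrangian_comp A C D (lagrangian_comp A B C N1 N2) N3"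
      unfolding mem_lagrangian_comp[of x w]
      using * N12.compI[OF *(4,5)] N2.memD(2)[OF *(5)] by (intro conjI exI[of _ r] exI[of _ z])
  qed
  show ?thesis using 1 2 by auto
qed

section \<open>The tensor product of pointed modules\<close>

text \<open>Padding by zero coefficients brings combinations over different generating sets to a
  common one.\<close>

lemma (in module) combination_mono_neutral:
  assumes "finite G" "S \<subseteq> G" "G \<subseteq> carrier M" "\<And>y. y \<in> S \<Longrightarrow> c y \<in> carrier R"
  shows "(\<Oplus>\<^bsub>M\<^esub>y\<in>S. c y \<odot>\<^bsub>M\<^esub> y) = (\<Oplus>\<^bsub>M\<^esub>y\<in>G. (if y \<in> S then c y else \<zero>\<^bsub>R\<^esub>) \<odot>\<^bsub>M\<^esub> y)"
  using assms by (intro M.add.finprod_mono_neutral_cong_left) (auto simp: subset_iff)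

lemma finitely_generated_sumI:
  fixes T :: "('a::idom, 'v, 'z) module_scheme"
  assumes "module base_ring T" "finite G" "G \<subseteq> carrier T"
    and "\<And>v. v \<in> carrier T \<Longrightarrow> \<exists>w\<^sub>1 w\<^sub>2. v = w\<^sub>1 \<oplus>\<^bsub>T\<^esub> w\<^sub>2 \<and>
      (\<exists>c. w\<^sub>1 = (\<Oplus>\<^bsub>T\<^esub>y\<in>G. c y \<odot>\<^bsub>T\<^esub> y)) \<and> (\<exists>c. w\<^sub>2 = (\<Oplus>\<^bsub>T\<^esub>y\<in>G. c y \<odot>\<^bsub>T\<^esub> y))"
  shows "finitely_generated T"
  unfolding finitely_generated_def
proof (intro exI[of _ G] conjI ballI)
  interpret T: module base_ring T by fact
  fix v assume "v \<in> carrier T"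
  then obtain c d where v: "v = (\<Oplus>\<^bsub>T\<^esub>y\<in>G. c y \<odot>\<^bsub>T\<^esub> y) \<oplus>\<^bsub>T\<^esub> (\<Oplus>\<^bsub>T\<^esub>y\<in>G. d y \<odot>\<^bsub>T\<^esub> y)"
    using assms(4) by blast
  have "(\<Oplus>\<^bsub>T\<^esub>y\<in>G. (c y + d y) \<odot>\<^bsub>T\<^esub> y) = (\<Oplus>\<^bsub>T\<^esub>y\<in>G. c y \<odot>\<^bsub>T\<^esub> y \<oplus>\<^bsub>T\<^esub> d y \<odot>\<^bsub>T\<^esub> y)"
    using assms(3) module_base_ring_simps[OF assms(1)]
    by (intro T.M.finsum_cong) (auto simp: simp_implies_def subset_iff)
  then show "\<exists>c. v = (\<Oplus>\<^bsub>T\<^esub>y\<in>G. c y \<odot>\<^bsub>T\<^esub> y)"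
    unfolding v using assms(3) by (subst T.M.finsum_addf[symmetric]) (auto intro!: exI[of _ "\<lambda>y. c y + d y"])
qed (use assms in auto)

text \<open>Coefficients are indexed by the generators themselves, so mapping the generators forces
  a reindexing along the inverse of \<open>\<iota>\<close>; injectivity keeps distinct generators
  distinct.\<close>

lemma combination_image:
  fixes M :: "('a::idom, 'u, 'y) module_scheme" and T :: "('a, 'v, 'z) module_scheme"
  assumes "module base_ring M" "module base_ring T" "inj_on \<iota> (carrier M)"
    and "\<And>x. x \<in> carrier M \<Longrightarrow> \<iota> x \<in> carrier T" "\<iota> \<zero>\<^bsub>M\<^esub> = \<zero>\<^bsub>T\<^esub>"
    and "\<And>x y. x \<in> carrier M \<Longrightarrow> y \<in> carrier M \<Longrightarrow> \<iota> (x \<oplus>\<^bsub>M\<^esub> y) = \<iota> x \<oplus>\<^bsub>T\<^esub> \<iota> y"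
    and "\<And>a x. x \<in> carrier M \<Longrightarrow> \<iota> (a \<odot>\<^bsub>M\<^esub> x) = a \<odot>\<^bsub>T\<^esub> \<iota> x"
    and "finite S" "S \<subseteq> carrier M"
  shows "\<iota> (\<Oplus>\<^bsub>M\<^esub>y\<in>S. c y \<odot>\<^bsub>M\<^esub> y) =
    (\<Oplus>\<^bsub>T\<^esub>v\<in>\<iota> ` S. c (inv_into (carrier M) \<iota> v) \<odot>\<^bsub>T\<^esub> v)"
  using assms(8,9)
proof (induction S rule: finite_induct)
  interpret M: module base_ring M by fact
  interpret T: module base_ring T by fact
  {
    case empty
    show ?case using assms(5) by simp
  next
    case (insert y S)
    have "\<iota> y \<notin> \<iota> ` S" using insert.hyps insert.prems inj_onD[OF assms(3)] by blast
    moreover have "(\<lambda>y. c y \<odot>\<^bsub>M\<^esub> y) \<in> S \<rightarrow> carrier M" using insert.prems by auto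
    moreover have "(\<lambda>v. c (inv_into (carrier M) \<iota> v) \<odot>\<^bsub>T\<^esub> v) \<in> \<iota> ` S \<rightarrow> carrier T"
      using insert.prems assms(4) by auto
    ultimately show ?case
      using insert assms(3-7) by (simp add: inv_into_f_f)
  }
qed

section \<open>Tensor products of objects\<close>

locale pairing =
  fixes pair :: "'u \<times> 'u \<Rightarrow> 'u"
  assumes inj_pair: "inj pair"
begin

lemma pair_eq_iff [simp]: "pair p = pair q \<longleftrightarrow> p = q"
  using inj_pair by (auto dest: injD)

text \<open>Unspecified off the range of \<open>pair\<close>. Elements of tensor objects lie in that
  range, and graphs only see such elements.\<close>

definition unpair where "unpair = inv_into UNIV pair"

lemma unpair_pair [simp]: "unpair (pair p) = p"
  using inj_pair by (simp add: unpair_def)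

end

definition tensor_object ::
  "('a::idom \<Rightarrow> 'a) \<Rightarrow> ('u \<times> 'u \<Rightarrow> 'u) \<Rightarrow> ('a, 'u) pointed_module \<Rightarrow> ('a, 'u) pointed_module \<Rightarrow>
    ('a, 'u) pointed_module" where
  "tensor_object bar pair A B = transport pair (module_sum (fst A) (fst B), twisted_form bar A B,
    fraction_pair (point A) (point B))"

locale tensor_pair = pairing pair + A: pointed_object bar A + B: pointed_object bar B
  for pair :: "'u \<times> 'u \<Rightarrow> 'u" and bar :: "'a::idom \<Rightarrow> 'a"
    and A B :: "('a, 'u) pointed_module"
begin

abbreviation T where "T \<equiv> tensor_object bar pair A B"

lemma inv_into_pair:
  "p \<in> elems A \<times> elems B \<Longrightarrow> inv_into (elems A \<times> elems B) pair (pair p) = p"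
  by (rule inv_into_f_f) (auto simp: inj_on_def)

lemma tensor_elems: "elems T = pair ` (elems A \<times> elems B)"
  by (simp add: tensor_object_def transport_def transport_module_def Let_def)

lemma tensor_zero: "\<zero>\<^bsub>fst T\<^esub> = pair (\<zero>\<^bsub>fst A\<^esub>, \<zero>\<^bsub>fst B\<^esub>)"
  by (simp add: tensor_object_def transport_def transport_module_def Let_def)

lemma tensor_mem [simp]: "pair (x, x') \<in> elems T \<longleftrightarrow> x \<in> elems A \<and> x' \<in> elems B"
  by (auto simp: tensor_elems)

lemma tensor_cases:
  assumes "v \<in> elems T"
  obtains x x' where "v = pair (x, x')" "x \<in> elems A" "x' \<in> elems B"
  using assms by (auto simp: tensor_elems)

lemma tensor_add:
  assumes "x \<in> elems A" "x' \<in> elems B" "y \<in> elems A" "y' \<in> elems B"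
  shows "pair (x, x') \<oplus>\<^bsub>fst T\<^esub> pair (y, y') = pair (x \<oplus>\<^bsub>fst A\<^esub> y, x' \<oplus>\<^bsub>fst B\<^esub> y')"
  using assms
  by (simp add: tensor_object_def transport_def transport_module_def Let_def inv_into_pair)

lemma tensor_smult:
  assumes "x \<in> elems A" "x' \<in> elems B"
  shows "a \<odot>\<^bsub>fst T\<^esub> pair (x, x') = pair (a \<odot>\<^bsub>fst A\<^esub> x, a \<odot>\<^bsub>fst B\<^esub> x')"
  using assms
  by (simp add: tensor_object_def transport_def transport_module_def Let_def inv_into_pair)

lemma tensor_form:
  assumes "x \<in> elems A" "x' \<in> elems B" "y \<in> elems A" "y' \<in> elems B"
  shows "form T (pair (x, x')) (pair (y, y')) = form A x y + form B x' y' +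
    to_point bar A x * from_point bar B y' - from_point bar A y * to_point bar B x'"
  using assms
proof -
  have "form T v w = twisted_form bar A B (inv_into (elems A \<times> elems B) pair v)
      (inv_into (elems A \<times> elems B) pair w)" for v w
    by (simp add: tensor_object_def transport_def Let_def)
  then have "form T (pair (x, x')) (pair (y, y')) = twisted_form bar A B (x, x') (y, y')"
    using assms by (simp add: inv_into_pair)
  then show ?thesis
    by (cases A; cases B) (simp add: twisted_form_def to_point_def from_point_def)
qed

lemma tensor_point: "point T = {(pair (h, h'), r) | h h' r. (h, r) \<in> point A \<and> (h', r) \<in> point B}"
  by (auto simp: tensor_object_def transport_def Let_def fraction_pair_def)

lemma tensor_point_mem [simp]:
  "(pair (h, h'), r) \<in> point T \<longleftrightarrow> (h, r) \<in> point A \<and> (h', r) \<in> point B"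
  by (auto simp: tensor_point)

lemma tensor_module: "module base_ring (fst T)"
proof -
  note rules = module_base_ring_simps[OF A.module_axioms] module_base_ring_simps[OF B.module_axioms]
  show ?thesis
    by (rule module_base_ringI)
      (auto simp: tensor_elems tensor_zero tensor_add tensor_smult rules A.a_assoc B.a_assoc
        intro: A.a_comm B.a_comm)
qed

lemma tensor_finitely_generated: "finitely_generated (fst T)"
proof -
  obtain S S' where S: "A.generates S" "B.generates S'"
    using A.generates_exists B.generates_exists by blast
  note fin = S[unfolded A.generates_def B.generates_def]
  let ?i = "\<lambda>x. pair (x, \<zero>\<^bsub>fst B\<^esub>)" and ?j = "\<lambda>x'. pair (\<zero>\<^bsub>fst A\<^esub>, x')"
  let ?G = "?i ` S \<union> ?j ` S'"
  interpret T: module base_ring "fst T" by (rule tensor_module)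
  have G: "finite ?G" "?G \<subseteq> elems T" using fin by auto
  have ext: "\<exists>c. (\<Oplus>\<^bsub>fst T\<^esub>y\<in>G'. d y \<odot>\<^bsub>fst T\<^esub> y) = (\<Oplus>\<^bsub>fst T\<^esub>y\<in>?G. c y \<odot>\<^bsub>fst T\<^esub> y)"
    if "G' \<subseteq> ?G" for G' d
    using T.combination_mono_neutral[OF G(1) that G(2), of d] by auto
  show ?thesis
  proof (rule finitely_generated_sumI[OF tensor_module G])
    fix v assume "v \<in> elems T"
    then obtain x x' where v: "v = pair (x, x')" "x \<in> elems A" "x' \<in> elems B"
      by (rule tensor_cases)
    obtain c where c: "x = (\<Oplus>\<^bsub>fst A\<^esub>y\<in>S. c y \<odot>\<^bsub>fst A\<^esub> y)" using fin(1) v(2) by blast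
    obtain c' where c': "x' = (\<Oplus>\<^bsub>fst B\<^esub>y\<in>S'. c' y \<odot>\<^bsub>fst B\<^esub> y)" using fin(2) v(3) by blast
    have "?i x = (\<Oplus>\<^bsub>fst T\<^esub>v\<in>?i ` S. c (inv_into (elems A) ?i v) \<odot>\<^bsub>fst T\<^esub> v)"
      unfolding c using fin
      by (intro combination_image[OF A.module_axioms tensor_module])
        (simp_all add: inj_on_def tensor_zero tensor_add tensor_smult)
    moreover have "?j x' = (\<Oplus>\<^bsub>fst T\<^esub>v\<in>?j ` S'. c' (inv_into (elems B) ?j v) \<odot>\<^bsub>fst T\<^esub> v)"
      unfolding c' using fin
      by (intro combination_image[OF B.module_axioms tensor_module])
        (simp_all add: inj_on_def tensor_zero tensor_add tensor_smult)
    moreover have "v = ?i x \<oplus>\<^bsub>fst T\<^esub> ?j x'" using v by (simp add: tensor_add)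
    ultimately show "\<exists>w\<^sub>1 w\<^sub>2. v = w\<^sub>1 \<oplus>\<^bsub>fst T\<^esub> w\<^sub>2 \<and>
        (\<exists>c. w\<^sub>1 = (\<Oplus>\<^bsub>fst T\<^esub>y\<in>?G. c y \<odot>\<^bsub>fst T\<^esub> y)) \<and> (\<exists>c. w\<^sub>2 = (\<Oplus>\<^bsub>fst T\<^esub>y\<in>?G. c y \<odot>\<^bsub>fst T\<^esub> y))"
      using ext[of "?i ` S"] ext[of "?j ` S'"] by (intro exI[of _ "?i x"] exI[of _ "?j x'"]) simp
  qed
qed

text \<open>Testing against \<open>s\<close> and \<open>s'\<close>, which are isotropic, removes the mixed terms of the form.\<close>

lemma tensor_nondegenerate: "inj_on (\<lambda>v. restrict (form T v) (elems T)) (elems T)"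
proof (rule inj_onI)
  fix v w assume vw: "v \<in> elems T" "w \<in> elems T"
    and eq: "restrict (form T v) (elems T) = restrict (form T w) (elems T)"
  obtain x x' where v: "v = pair (x, x')" "x \<in> elems A" "x' \<in> elems B"
    using vw(1) by (rule tensor_cases)
  obtain u u' where w: "w = pair (u, u')" "u \<in> elems A" "u' \<in> elems B"
    using vw(2) by (rule tensor_cases)
  have eq: "form T v (pair (y, y')) = form T w (pair (y, y'))" if "y \<in> elems A" "y' \<in> elems B" for y y'
    using fun_cong[OF eq, of "pair (y, y')"] that by simp
  obtain h r where h: "(h, r) \<in> point A" using A.point_nonempty by blast
  note hD = A.point_memD[OF h]
  have "form A x h = form A u h"
    using eq[OF hD(1) B.zero_closed] hD v w by (simp add: tensor_form A.from_point_self[OF h])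
  then have to_eq: "to_point bar A x = to_point bar A u"
    using A.to_point_eq[OF h v(2)] A.to_point_eq[OF h w(2)] hD by (auto dest: sym)
  \<comment> \<open>With \<open>to_point\<close> equal on \<open>x\<close> and \<open>u\<close>,
    tests against (0, z) have equal mixed terms and give x' = u'; this in turn equalises the mixed
    terms of the tests against (z, 0).\<close>
  have "x' = u'"
  proof (rule B.form_eqI[OF v(3) w(3)])
    fix z assume "z \<in> elems B"
    then show "form B x' z = form B u' z"
      using eq[OF A.zero_closed, of z] v w to_eq by (simp add: tensor_form)
  qed
  moreover have "x = u"
  proof (rule A.form_eqI[OF v(2) w(2)])
    fix z assume "z \<in> elems A"
    then show "form A x z = form A u z"
      using eq[OF _ B.zero_closed, of z] v w \<open>x' = u'\<close> by (simp add: tensor_form)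
  qed
  ultimately show "v = w" using v w by simp
qed

text \<open>Exchanging the arguments and applying the negative conjugate swaps the two mixed terms,
  since \<rho>(x, s) is the negative conjugate of \<rho>(s, x); this accounts for their opposite
  signs.\<close>

lemma tensor_skew_hermitian: "skew_hermitian_module (fst T) bar (form T)"
proof (intro skew_hermitian_module.intro skew_hermitian_module_axioms.intro)
  fix v w z a
  assume "v \<in> elems T"
  then obtain x x' where v: "v = pair (x, x')" "x \<in> elems A" "x' \<in> elems B"
    by (rule tensor_cases)
  assume "z \<in> elems T"
  then obtain y y' where z: "z = pair (y, y')" "y \<in> elems A" "y' \<in> elems B"
    by (rule tensor_cases)
  note pts = A.from_point_add B.from_point_add A.to_point_add B.to_point_add
    A.from_point_smult B.from_point_smult A.to_point_smult B.to_point_smult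
  show "form T (a \<odot>\<^bsub>fst T\<^esub> v) z = a * form T v z"
    using v z by (simp add: tensor_smult tensor_form A.form_smult_left B.form_smult_left pts
        algebra_simps)
  show "form T z (a \<odot>\<^bsub>fst T\<^esub> v) = bar a * form T z v"
    using v z by (simp add: tensor_smult tensor_form A.form_smult_right B.form_smult_right pts
        algebra_simps)
  show "form T v z = - bar (form T z v)"
    using v z A.form_skew[of x y] B.form_skew[of x' y']
    by (simp add: tensor_form A.to_point_eq_bar B.to_point_eq_bar algebra_simps)
  assume "w \<in> elems T"
  then obtain u u' where w: "w = pair (u, u')" "u \<in> elems A" "u' \<in> elems B"
    by (rule tensor_cases)
  show "form T (v \<oplus>\<^bsub>fst T\<^esub> w) z = form T v z + form T w z"
    using v w z by (simp add: tensor_add tensor_form A.form_add_left B.form_add_left pts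
        algebra_simps)
  show "form T z (v \<oplus>\<^bsub>fst T\<^esub> w) = form T z v + form T z w"
    using v w z by (simp add: tensor_add tensor_form A.form_add_right B.form_add_right pts
        algebra_simps)
qed (use tensor_module tensor_finitely_generated tensor_nondegenerate in auto)

end

context tensor_pair
begin

lemma common_denominator: "\<exists>h h' r. (h, r) \<in> point A \<and> (h', r) \<in> point B"
proof -
  obtain h r h' r' where *: "(h, r) \<in> point A" "(h', r') \<in> point B"
    using A.point_nonempty B.point_nonempty by blast
  then have "(r' \<odot>\<^bsub>fst A\<^esub> h, r' * r) \<in> point A" "(r \<odot>\<^bsub>fst B\<^esub> h', r' * r) \<in> point B"
    using A.point_smult[OF *(1), of r'] B.point_smult[OF *(2), of r] A.point_memD(2)[OF *(1)]
      B.point_memD(2)[OF *(2)] by (simp_all add: mult.commute)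
  then show ?thesis by blast
qed

text \<open>Against (s, s') in the left slot each mixed term contains \<rho>(s, s) or \<rho>'(s',
  s') as a factor and vanishes. What remains is \<rho>(s, y) + \<rho>'(s', y'), which is integral,
  and zero at the point itself.\<close>

lemma tensor_pointed: "pointed_object bar T"
proof -
  interpret T: skew_hermitian_involution "fst T" bar "form T"
    using tensor_skew_hermitian A.involution_bar
    by (simp add: skew_hermitian_involution_def skew_hermitian_involution_axioms_def)
  obtain h h' r where *: "(h, r) \<in> point A" "(h', r) \<in> point B" using common_denominator by blast
  note D = A.point_memD(1,2)[OF *(1)] B.point_memD(1)[OF *(2)]
  have hT: "pair (h, h') \<in> elems T" using D by simp
  have p: "point T = fraction (fst T) (pair (h, h')) r"
  proof -
    have "(k, t) \<in> point T \<longleftrightarrow> k \<in> elems T \<and> t \<noteq> 0 \<and> t \<odot>\<^bsub>fst T\<^esub> pair (h, h') = r \<odot>\<^bsub>fst T\<^esub> k" for k t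
      using D by (auto simp: tensor_point tensor_elems tensor_smult A.point_mem_iff[OF *(1)]
          B.point_mem_iff[OF *(2)])
    then show ?thesis by (auto simp: T.mem_fraction[OF hT D(2)])
  qed
  have "form T (pair (h, h')) (pair (h, h')) = 0"
    using D * by (simp add: tensor_form A.point_isotropic B.point_isotropic A.to_point_self A.from_point_self)
  moreover have "r dvd form T (pair (h, h')) v" if vT: "v \<in> elems T" for v
  proof -
    obtain y y' where v: "v = pair (y, y')" "y \<in> elems A" "y' \<in> elems B"
      using vT by (rule tensor_cases)
    then have "form T (pair (h, h')) v = r * from_point bar A y + r * from_point bar B y'"
      using D * by (simp add: tensor_form A.to_point_self B.to_point_self A.from_point_eq B.from_point_eq)
    then show ?thesis by (simp add: distrib_left[symmetric])
  qed
  ultimately have "form_Q bar (form T) (point T) (point T) = 0"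
      "\<forall>x\<in>elems T. form_Q bar (form T) (point T) (fraction (fst T) x 1) \<in> range to_fract"
    using T.pointed_skew_hermitianI[OF hT D(2)] unfolding p by blast+
  moreover have "point T \<in> fractions (fst T)" unfolding p using hT D by simp
  ultimately have "pointed_skew_hermitian bar T"
    using tensor_skew_hermitian unfolding pointed_skew_hermitian_def by (simp add: case_prod_beta)
  then show ?thesis using A.involution_bar by unfold_locales
qed

text \<open>Again the mixed terms die by isotropy. This additivity is what makes iterated twisted
  forms comparable.\<close>

lemma tensor_from_point:
  assumes "x \<in> elems A" "x' \<in> elems B"
  shows "from_point bar T (pair (x, x')) = from_point bar A x + from_point bar B x'"
proof -
  interpret T: pointed_object bar T by (rule tensor_pointed)
  obtain h h' r where *: "(h, r) \<in> point A" "(h', r) \<in> point B" using common_denominator by blast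
  show ?thesis
    using assms A.point_memD(1)[OF *(1)] B.point_memD(1)[OF *(2)] *
    by (intro T.from_point_unique[of "pair (h, h')" r]) (simp_all add: tensor_form
        A.to_point_self B.to_point_self A.from_point_eq B.from_point_eq distrib_left)
qed

lemma tensor_to_point:
  assumes "x \<in> elems A" "x' \<in> elems B"
  shows "to_point bar T (pair (x, x')) = to_point bar A x + to_point bar B x'"
proof -
  interpret T: pointed_object bar T by (rule tensor_pointed)
  show ?thesis
    using assms by (simp add: T.to_point_eq_bar A.to_point_eq_bar B.to_point_eq_bar tensor_from_point)
qed

end


section \<open>Tensor products of Lagrangian relations\<close>

context pairing
begin

lemma mem_relation_sum [simp]:
  "(pair (h, h'), pair (k, k')) \<in> relation_sum pair N N' \<longleftrightarrow> (h, k) \<in> N \<and> (h', k') \<in> N'"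
  by (auto simp: relation_sum_def)

definition pair_map :: "('u \<Rightarrow> 'u) \<Rightarrow> ('u \<Rightarrow> 'u) \<Rightarrow> 'u \<Rightarrow> 'u" where
  "pair_map \<phi> \<psi> v = (case unpair v of (x, x') \<Rightarrow> pair (\<phi> x, \<psi> x'))"

lemma pair_map_pair [simp]: "pair_map \<phi> \<psi> (pair (x, x')) = pair (\<phi> x, \<psi> x')"
  by (simp add: pair_map_def)

definition assoc_map :: "'u \<Rightarrow> 'u" where
  "assoc_map v = (case unpair v of (w, d) \<Rightarrow> case unpair w of (a, b) \<Rightarrow> pair (a, pair (b, d)))"

lemma assoc_map_pair [simp]: "assoc_map (pair (pair (a, b), d)) = pair (a, pair (b, d))"
  by (simp add: assoc_map_def)

end

locale tensor_lagrangians = pairing pair + N: pointed_lagrangian bar A B N +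
    N': pointed_lagrangian bar A' B' N'
  for pair :: "'u \<times> 'u \<Rightarrow> 'u" and bar :: "'a::idom \<Rightarrow> 'a"
    and A B A' B' :: "('a, 'u) pointed_module" and N N' :: "('u \<times> 'u) set"

sublocale tensor_lagrangians \<subseteq> TA: tensor_pair pair bar A A' ..
sublocale tensor_lagrangians \<subseteq> TB: tensor_pair pair bar B B' ..

context tensor_lagrangians
begin

text \<open>
  Testing against representatives of the two points first shows that \<open>\<rho>(x,s) = \<tau>(y,t)\<close> and
  \<open>\<rho>'(x',s') = \<tau>'(y',t')\<close>; then the mixed terms cancel in all other tests.
\<close>

lemma tensor_perp:
  assumes "x \<in> elems A" "x' \<in> elems A'" "y \<in> elems B" "y' \<in> elems B'"
    and perp: "\<And>h k h' k'. (h, k) \<in> N \<Longrightarrow> (h', k') \<in> N' \<Longrightarrow>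
      form TA.T (pair (x, x')) (pair (h, h')) = form TB.T (pair (y, y')) (pair (k, k'))"
  shows "(x, y) \<in> N \<and> (x', y') \<in> N'"
proof -
  have perp: "form A x h + form A' x' h' + to_point bar A x * from_point bar A' h' -
      from_point bar A h * to_point bar A' x' =
    form B y k + form B' y' k' + to_point bar B y * from_point bar B' k' -
      from_point bar B k * to_point bar B' y'"
    if "(h, k) \<in> N" "(h', k') \<in> N'" for h k h' k'
    using perp[OF that] N.memD[OF that(1)] N'.memD[OF that(2)] assms(1-4)
    by (simp add: TA.tensor_form TB.tensor_form)
  obtain a b r where ab: "(a, b) \<in> N" "(a, r) \<in> point A" "(b, r) \<in> point B"
    using N.point_rep by blast
  obtain a' b' r' where ab': "(a', b') \<in> N'" "(a', r') \<in> point A'" "(b', r') \<in> point B'"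
    using N'.point_rep by blast
  have "form A x a = form B y b"
    using perp[OF ab(1) N'.zero] assms(1-4)
    by (simp add: N.A.from_point_self[OF ab(2)] N.B.from_point_self[OF ab(3)])
  then have "bar r * to_point bar A x = bar r * to_point bar B y"
    using assms(1-4) by (simp add: N.A.to_point_eq[OF ab(2)] N.B.to_point_eq[OF ab(3)])
  then have to: "to_point bar A x = to_point bar B y"
    using N.A.point_memD(2)[OF ab(2)] by simp
  have "form A' x' a' = form B' y' b'"
    using perp[OF N.zero ab'(1)] assms(1-4)
    by (simp add: N'.A.from_point_self[OF ab'(2)] N'.B.from_point_self[OF ab'(3)])
  then have "bar r' * to_point bar A' x' = bar r' * to_point bar B' y'"
    using assms(1-4) by (simp add: N'.A.to_point_eq[OF ab'(2)] N'.B.to_point_eq[OF ab'(3)])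
  then have to': "to_point bar A' x' = to_point bar B' y'"
    using N'.A.point_memD(2)[OF ab'(2)] by simp
  have "form A x h = form B y k" if "(h, k) \<in> N" for h k
    using perp[OF that N'.zero] assms(1-4) by (simp add: N.from_point_eq[OF that] to')
  moreover have "form A' x' h' = form B' y' k'" if "(h', k') \<in> N'" for h' k'
    using perp[OF N.zero that] assms(1-4) by (simp add: N'.from_point_eq[OF that] to)
  ultimately show ?thesis using assms(1-4) by (intro conjI N.memI N'.memI)
qed

text \<open>Isotropy holds because \<open>N\<close> and \<open>N'\<close> preserve the functionals
  occurring in the mixed terms; maximality is \<open>tensor_perp\<close>.\<close>

lemma tensor_lagrangian: "pointed_lagrangian bar TA.T TB.T (relation_sum pair N N')"
proof -
  interpret TA: pointed_object bar TA.T by (rule TA.tensor_pointed)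
  interpret TB: pointed_object bar TB.T by (rule TB.tensor_pointed)
  have "lagrangian_relation TA.T TB.T (relation_sum pair N N')"
    unfolding lagrangian_relation_iff[OF TA.tensor_pointed TB.tensor_pointed]
  proof (intro conjI ballI)
    show "relation_sum pair N N' \<subseteq> elems TA.T \<times> elems TB.T"
      by (auto simp: relation_sum_def N.memD N'.memD)
  next
    fix v w assume vT: "v \<in> elems TA.T" and wT: "w \<in> elems TB.T"
    obtain x x' where v: "v = pair (x, x')" "x \<in> elems A" "x' \<in> elems A'"
      using vT by (rule TA.tensor_cases)
    obtain y y' where w: "w = pair (y, y')" "y \<in> elems B" "y' \<in> elems B'"
      using wT by (rule TB.tensor_cases)
    have "form TA.T v (pair (h, h')) = form TB.T w (pair (k, k'))"
      if "(h, k) \<in> N" "(h', k') \<in> N'" "(x, y) \<in> N" "(x', y') \<in> N'" for h k h' k'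
      using v w N.memD[OF that(1)] N'.memD[OF that(2)] N.form_eq[OF that(3,1)] N'.form_eq[OF that(4,2)]
        N.from_point_eq[OF that(1)] N'.from_point_eq[OF that(2)]
        N.to_point_eq[OF that(3)] N'.to_point_eq[OF that(4)]
      by (simp add: TA.tensor_form TB.tensor_form)
    then have "\<forall>(a, b)\<in>relation_sum pair N N'. form TA.T v a = form TB.T w b"
      if "(v, w) \<in> relation_sum pair N N'"
      using that v w by (auto simp: relation_sum_def)
    moreover have "(v, w) \<in> relation_sum pair N N'"
      if "\<forall>(a, b)\<in>relation_sum pair N N'. form TA.T v a = form TB.T w b"
    proof -
      have "form TA.T (pair (x, x')) (pair (h, h')) = form TB.T (pair (y, y')) (pair (k, k'))"
        if "(h, k) \<in> N" "(h', k') \<in> N'" for h k h' k'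
        using \<open>\<forall>(a, b)\<in>relation_sum pair N N'. _\<close> that v w by fastforce
      from tensor_perp[OF v(2,3) w(2,3) this] show ?thesis using v w by simp
    qed
    ultimately show "(v, w) \<in> relation_sum pair N N' \<longleftrightarrow>
        (\<forall>(a, b)\<in>relation_sum pair N N'. form TA.T v a = form TB.T w b)" by blast
  next
    obtain a b r where ab: "(a, b) \<in> N" "(a, r) \<in> point A" "(b, r) \<in> point B"
      using N.point_rep by blast
    obtain a' b' r' where ab': "(a', b') \<in> N'" "(a', r') \<in> point A'" "(b', r') \<in> point B'"
      using N'.point_rep by blast
    have nz: "r \<noteq> 0" "r' \<noteq> 0" using N.A.point_memD(2)[OF ab(2)] N'.A.point_memD(2)[OF ab'(2)] by auto
    \<comment> \<open>The points of the two relations come with denominators \<open>r\<close> and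
      \<open>r'\<close>; scaling crosswise puts all four over \<open>r * r'\<close>.\<close>
    have "(pair (r' \<odot>\<^bsub>fst A\<^esub> a, r \<odot>\<^bsub>fst A'\<^esub> a'), r * r') \<in> point TA.T"
      using N.A.point_smult[OF ab(2) nz(2)] N'.A.point_smult[OF ab'(2) nz(1)]
      by (simp add: mult.commute)
    moreover have "(pair (r' \<odot>\<^bsub>fst B\<^esub> b, r \<odot>\<^bsub>fst B'\<^esub> b'), r * r') \<in> point TB.T"
      using N.B.point_smult[OF ab(3) nz(2)] N'.B.point_smult[OF ab'(3) nz(1)]
      by (simp add: mult.commute)
    moreover have "(pair (r' \<odot>\<^bsub>fst A\<^esub> a, r \<odot>\<^bsub>fst A'\<^esub> a'), pair (r' \<odot>\<^bsub>fst B\<^esub> b, r \<odot>\<^bsub>fst B'\<^esub> b'))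
        \<in> relation_sum pair N N'"
      using N.smult[OF ab(1)] N'.smult[OF ab'(1)] by simp
    ultimately show "\<exists>a b r. (a, b) \<in> relation_sum pair N N' \<and> (a, r) \<in> point TA.T \<and> (b, r) \<in> point TB.T"
      by blast
  qed
  then show ?thesis by unfold_locales
qed

end

text \<open>Injectivity is obtained from preservation of the form, because the form on the source is
  non-degenerate.\<close>

lemma isometryI:
  assumes "pointed_object bar A" "\<And>x. x \<in> elems A \<Longrightarrow> \<phi> x \<in> elems B"
    and "\<And>z. z \<in> elems B \<Longrightarrow> \<exists>x\<in>elems A. z = \<phi> x"
    and "\<And>x y. x \<in> elems A \<Longrightarrow> y \<in> elems A \<Longrightarrow> form B (\<phi> x) (\<phi> y) = form A x y"
    and "(h, r) \<in> point A" "(\<phi> h, r) \<in> point B"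
  shows "isometry A B \<phi>"
proof -
  interpret A: pointed_object bar A by fact
  have "inj_on \<phi> (elems A)"
  proof (rule inj_onI)
    fix x y assume "x \<in> elems A" "y \<in> elems A" "\<phi> x = \<phi> y"
    then show "x = y" using assms(4) by (intro A.form_eqI) metis+
  qed
  moreover have "\<phi> ` elems A = elems B" using assms(2,3) by blast
  ultimately show ?thesis using assms(4-6) by (auto simp: isometry_def bij_betw_def)
qed

text \<open>An \<open>isometry\<close> matches the points in one representative; compatibility with
  scalars carries the cross-multiplication relation, and with it all representatives,
  across.\<close>

lemma isometry_point:
  assumes "pointed_object bar A" "pointed_object bar B" "isometry A B \<phi>" "(h, r) \<in> point A"
  shows "(\<phi> h, r) \<in> point B"
proof -
  interpret A: pointed_object bar A by fact
  interpret B: pointed_object bar B by fact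
  obtain h0 r0 where *: "(h0, r0) \<in> point A" "(\<phi> h0, r0) \<in> point B"
    using isometryD(4)[OF assms(3)] by blast
  note smult = isometry_smult[OF assms(1-3)]
  have h: "h \<in> elems A" "r \<noteq> 0" "r \<odot>\<^bsub>fst A\<^esub> h0 = r0 \<odot>\<^bsub>fst A\<^esub> h"
    using assms(4) A.point_mem_iff[OF *(1)] by auto
  then show ?thesis
    using isometryD(1)[OF assms(3) h(1)] smult[of h0 r] smult[of h r0] A.point_memD(1)[OF *(1)]
    by (simp add: B.point_mem_iff[OF *(2)])
qed

lemma isometry_comp:
  assumes "pointed_object bar A" "pointed_object bar B" "pointed_object bar C"
    and "isometry A B \<phi>" "isometry B C \<psi>"
  shows "isometry A C (\<lambda>x. \<psi> (\<phi> x))"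
proof -
  obtain h r where h: "(h, r) \<in> point A" using pointed_object.point_nonempty[OF assms(1)] by blast
  note \<phi> = isometryD[OF assms(4)] and \<psi> = isometryD[OF assms(5)]
  show ?thesis
  proof (rule isometryI[OF assms(1)])
    show "(h, r) \<in> point A" by fact
    show "(\<psi> (\<phi> h), r) \<in> point C"
      using isometry_point[OF assms(1,2,4) h] isometry_point[OF assms(2,3,5)] by blast
    show "\<exists>x\<in>elems A. z = \<psi> (\<phi> x)" if "z \<in> elems C" for z
      using \<psi>(3)[OF that] \<phi>(3) by blast
  qed (simp_all add: \<phi>(1,2) \<psi>(1,2))
qed

text \<open>The graph is a Lagrangian relation, so the invariance of the functionals along such
  relations applies.\<close>

lemma isometry_from_point:
  assumes "pointed_object bar A" "pointed_object bar B" "isometry A B \<phi>" "x \<in> elems A"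
  shows "from_point bar B (\<phi> x) = from_point bar A x" "to_point bar B (\<phi> x) = to_point bar A x"
proof -
  interpret pointed_lagrangian bar A B "{(x, \<phi> x) | x. x \<in> elems A}"
    by (rule isometry_graph[OF assms(1-3)])
  show "from_point bar B (\<phi> x) = from_point bar A x" "to_point bar B (\<phi> x) = to_point bar A x"
    using from_point_eq[of x "\<phi> x"] to_point_eq[of x "\<phi> x"] assms(4) by auto
qed

text \<open>The zero module. The universe has no designated zero, so \<open>undefined\<close> is its
  only element; the point is the zero fraction, whose class contains every non-zero
  denominator.\<close>

definition unit_object :: "('a::idom, 'u) pointed_module" where
  "unit_object = (\<lparr>carrier = {undefined}, monoid.mult = undefined, one = undefined,
    ring.zero = undefined, add = (\<lambda>_ _. undefined), module.smult = (\<lambda>_ _. undefined)\<rparr>,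
    (\<lambda>_ _. 0), {undefined} \<times> (UNIV - {0}))"

lemma unit_object_simps [simp]:
  "elems unit_object = {undefined}" "form unit_object x y = 0"
  "point unit_object = {undefined} \<times> (UNIV - {0})"
  by (simp_all add: unit_object_def)

lemma unit_object_pointed:
  assumes "ring_involution bar"
  shows "pointed_object bar (unit_object :: ('a::idom, 'u) pointed_module)"
proof -
  let ?U = "unit_object :: ('a, 'u) pointed_module"
  have M: "module base_ring (fst ?U)"
    by (rule module_base_ringI) (simp_all add: unit_object_def)
  interpret U: module base_ring "fst ?U" by (rule M)
  have "\<exists>c. x = (\<Oplus>\<^bsub>fst ?U\<^esub>y\<in>{}. c y \<odot>\<^bsub>fst ?U\<^esub> y)" if "x \<in> elems ?U" for x
  proof -
    have "x = \<zero>\<^bsub>fst ?U\<^esub>" using that by (simp add: unit_object_def)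
    then show ?thesis by (simp del: unit_object_simps)
  qed
  then have fg: "finitely_generated (fst ?U)"
    unfolding finitely_generated_def by (intro exI[of _ "{}"]) auto
  have "bar 0 = 0" using ring_involution_simps(5)[OF assms] .
  then have sk: "skew_hermitian_module (fst ?U) bar (form ?U)"
    using M fg by (intro skew_hermitian_module.intro skew_hermitian_module_axioms.intro) auto
  interpret U: skew_hermitian_involution "fst ?U" bar "form ?U"
    using sk assms by (simp add: skew_hermitian_involution_def skew_hermitian_involution_axioms_def)
  have u: "undefined \<in> elems ?U" by simp
  have p: "point ?U = fraction (fst ?U) undefined 1"
    using U.mem_fraction[OF u, of 1] U.smult_closed[OF _ u] by (auto simp: unit_object_def)
  have "form_Q bar (form ?U) (point ?U) (point ?U) = 0"
      "\<forall>x\<in>elems ?U. form_Q bar (form ?U) (point ?U) (fraction (fst ?U) x 1) \<in> range to_fract"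
    unfolding p by (rule U.pointed_skew_hermitianI; simp)+
  moreover have "point ?U \<in> fractions (fst ?U)" unfolding p by simp
  ultimately have "pointed_skew_hermitian bar ?U"
    using sk unfolding pointed_skew_hermitian_def case_prod_beta by blast
  then show ?thesis using assms by unfold_locales
qed

lemma unit_object_from_point:
  assumes "ring_involution bar"
  shows "from_point bar unit_object undefined = 0" "to_point bar unit_object undefined = 0"
proof -
  interpret U: pointed_object bar unit_object by (rule unit_object_pointed[OF assms])
  show "from_point bar unit_object undefined = 0" "to_point bar unit_object undefined = 0"
    by (rule U.from_point_unique[of undefined 1] U.to_point_unique[of undefined 1]; simp)+
qed

section \<open>Structure isometries and interchange\<close>

locale involutive_pairing = pairing pair
  for pair :: "'u \<times> 'u \<Rightarrow> 'u" +
  fixes bar :: "'a::idom \<Rightarrow> 'a"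
  assumes involution: "ring_involution bar"
begin

abbreviation tensor (infixr \<open>\<otimes>\<^sub>p\<close> 70) where
  "A \<otimes>\<^sub>p B \<equiv> tensor_object bar pair A B"

abbreviation obj :: "('a, 'u) pointed_module \<Rightarrow> bool" where
  "obj \<equiv> pointed_object bar"

lemma tensor_pairI: "obj A \<Longrightarrow> obj B \<Longrightarrow> tensor_pair pair bar A B"
  using inj_pair by (simp add: tensor_pair_def pairing_def)

lemma obj_tensor: "obj A \<Longrightarrow> obj B \<Longrightarrow> obj (A \<otimes>\<^sub>p B)"
  using tensor_pairI tensor_pair.tensor_pointed by blast

lemma obj_unit: "obj unit_object"
  by (rule unit_object_pointed[OF involution])

lemma isometry_tensor:
  assumes "obj A" "obj B" "obj A'" "obj B'" "isometry A B \<phi>" "isometry A' B' \<psi>"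
  shows "isometry (A \<otimes>\<^sub>p A') (B \<otimes>\<^sub>p B') (pair_map \<phi> \<psi>)"
proof -
  interpret TA: tensor_pair pair bar A A' by (rule tensor_pairI[OF assms(1,3)])
  interpret TB: tensor_pair pair bar B B' by (rule tensor_pairI[OF assms(2,4)])
  note \<phi> = isometryD[OF assms(5)] isometry_from_point[OF assms(1,2,5)]
  note \<psi> = isometryD[OF assms(6)] isometry_from_point[OF assms(3,4,6)]
  obtain h h' r where *: "(h, r) \<in> point A" "(h', r) \<in> point A'" using TA.common_denominator by blast
  show ?thesis
  proof (rule isometryI[OF TA.tensor_pointed])
    show "(pair (h, h'), r) \<in> point TA.T" using * by simp
    show "(pair_map \<phi> \<psi> (pair (h, h')), r) \<in> point TB.T"
      using isometry_point[OF assms(1,2,5) *(1)] isometry_point[OF assms(3,4,6) *(2)] by simp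
    fix v assume "v \<in> elems TA.T"
    then obtain x x' where v: "v = pair (x, x')" "x \<in> elems A" "x' \<in> elems A'" by (rule TA.tensor_cases)
    then show "pair_map \<phi> \<psi> v \<in> elems TB.T" using \<phi>(1) \<psi>(1) by simp
    fix w assume "w \<in> elems TA.T"
    then obtain y y' where w: "w = pair (y, y')" "y \<in> elems A" "y' \<in> elems A'" by (rule TA.tensor_cases)
    show "form TB.T (pair_map \<phi> \<psi> v) (pair_map \<phi> \<psi> w) = form TA.T v w"
      using v w by (simp add: TA.tensor_form TB.tensor_form \<phi> \<psi>)
  next
    fix w assume "w \<in> elems TB.T"
    then obtain y y' where w: "w = pair (y, y')" "y \<in> elems B" "y' \<in> elems B'" by (rule TB.tensor_cases)
    obtain x where x: "x \<in> elems A" "y = \<phi> x" using \<phi>(3) w(2) by blast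
    obtain x' where x': "x' \<in> elems A'" "y' = \<psi> x'" using \<psi>(3) w(3) by blast
    show "\<exists>v\<in>elems TA.T. w = pair_map \<phi> \<psi> v"
      using w x x' by (intro bexI[of _ "pair (x, x')"]) simp_all
  qed
qed

text \<open>By additivity of the functionals on tensor products, both bracketings expand to the
  three forms plus mixed terms for the pairs (A, B), (A, D) and (B, D).\<close>

lemma isometry_assoc_map:
  assumes "obj A" "obj B" "obj D"
  shows "isometry ((A \<otimes>\<^sub>p B) \<otimes>\<^sub>p D) (A \<otimes>\<^sub>p (B \<otimes>\<^sub>p D)) assoc_map"
proof -
  interpret AB: tensor_pair pair bar A B by (rule tensor_pairI[OF assms(1,2)])
  interpret BD: tensor_pair pair bar B D by (rule tensor_pairI[OF assms(2,3)])
  interpret L: tensor_pair pair bar AB.T D by (rule tensor_pairI[OF AB.tensor_pointed assms(3)])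
  interpret R: tensor_pair pair bar A BD.T by (rule tensor_pairI[OF assms(1) BD.tensor_pointed])
  obtain h d r where *: "(h, r) \<in> point AB.T" "(d, r) \<in> point D" using L.common_denominator by blast
  then obtain a b where h: "h = pair (a, b)" using AB.tensor_point by auto
  have cases: thesis if "v \<in> elems L.T" "\<And>a b d. v = pair (pair (a, b), d) \<Longrightarrow> a \<in> elems A \<Longrightarrow>
      b \<in> elems B \<Longrightarrow> d \<in> elems D \<Longrightarrow> thesis" for v thesis
    using that(1) by (elim L.tensor_cases AB.tensor_cases) (use that(2) in auto)
  show ?thesis
  proof (rule isometryI[OF L.tensor_pointed])
    show "(pair (pair (a, b), d), r) \<in> point L.T" using * h by simp
    show "(assoc_map (pair (pair (a, b), d)), r) \<in> point R.T" using * h by simp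
    fix v assume "v \<in> elems L.T"
    then obtain a b d where v: "v = pair (pair (a, b), d)" "a \<in> elems A" "b \<in> elems B" "d \<in> elems D"
      by (rule cases)
    then show "assoc_map v \<in> elems R.T" by simp
    fix w assume "w \<in> elems L.T"
    then obtain a' b' d' where w: "w = pair (pair (a', b'), d')" "a' \<in> elems A" "b' \<in> elems B" "d' \<in> elems D"
      by (rule cases)
    show "form R.T (assoc_map v) (assoc_map w) = form L.T v w"
      using v w by (simp add: L.tensor_form R.tensor_form AB.tensor_form BD.tensor_form
          AB.tensor_from_point AB.tensor_to_point BD.tensor_from_point BD.tensor_to_point algebra_simps)
  next
    fix w assume "w \<in> elems R.T"
    then obtain a z where az: "w = pair (a, z)" "a \<in> elems A" "z \<in> elems BD.T" by (rule R.tensor_cases)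
    from az(3) obtain b d where bd: "z = pair (b, d)" "b \<in> elems B" "d \<in> elems D" by (rule BD.tensor_cases)
    show "\<exists>v\<in>elems L.T. w = assoc_map v"
      using az bd by (intro bexI[of _ "pair (pair (a, b), d)"]) simp_all
  qed
qed

text \<open>The form and both functionals vanish on the zero module, so the mixed terms disappear
  and only the form of \<open>A\<close> is left.\<close>

lemma isometry_lunit:
  assumes "obj A"
  shows "isometry (unit_object \<otimes>\<^sub>p A) A (\<lambda>v. snd (unpair v))"
proof -
  interpret A: pointed_object bar A by fact
  interpret T: tensor_pair pair bar unit_object A by (rule tensor_pairI[OF obj_unit assms])
  obtain h r where h: "(h, r) \<in> point A" using A.point_nonempty by blast
  show ?thesis
  proof (rule isometryI[OF T.tensor_pointed])
    show "(pair (undefined, h), r) \<in> point T.T" using h A.point_memD(2)[OF h] by simp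
    show "(snd (unpair (pair (undefined, h))), r) \<in> point A" using h by simp
    show "\<exists>v\<in>elems T.T. z = snd (unpair v)" if "z \<in> elems A" for z
      using that by (intro bexI[of _ "pair (undefined, z)"]) simp_all
  qed (auto elim!: T.tensor_cases simp: T.tensor_form unit_object_from_point[OF involution])
qed

lemma isometry_runit:
  assumes "obj A"
  shows "isometry (A \<otimes>\<^sub>p unit_object) A (\<lambda>v. fst (unpair v))"
proof -
  interpret A: pointed_object bar A by fact
  interpret T: tensor_pair pair bar A unit_object by (rule tensor_pairI[OF assms obj_unit])
  obtain h r where h: "(h, r) \<in> point A" using A.point_nonempty by blast
  show ?thesis
  proof (rule isometryI[OF T.tensor_pointed])
    show "(pair (h, undefined), r) \<in> point T.T" using h A.point_memD(2)[OF h] by simp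
    show "(fst (unpair (pair (h, undefined))), r) \<in> point A" using h by simp
    show "\<exists>v\<in>elems T.T. z = fst (unpair v)" if "z \<in> elems A" for z
      using that by (intro bexI[of _ "pair (z, undefined)"]) simp_all
  qed (auto elim!: T.tensor_cases simp: T.tensor_form unit_object_from_point[OF involution])
qed

lemma relation_sum_comp:
  assumes "pointed_lagrangian bar A B N1" "pointed_lagrangian bar B C N2"
    and "pointed_lagrangian bar A' B' N1'" "pointed_lagrangian bar B' C' N2'"
  shows "relation_sum pair (lagrangian_comp A B C N1 N2) (lagrangian_comp A' B' C' N1' N2') =
    lagrangian_comp (A \<otimes>\<^sub>p A') (B \<otimes>\<^sub>p B') (C \<otimes>\<^sub>p C') (relation_sum pair N1 N1') (relation_sum pair N2 N2')"
proof -
  interpret N1: pointed_lagrangian bar A B N1 by fact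
  interpret N2: pointed_lagrangian bar B C N2 by fact
  interpret N1': pointed_lagrangian bar A' B' N1' by fact
  interpret N2': pointed_lagrangian bar B' C' N2' by fact
  interpret T1: tensor_lagrangians pair bar A B A' B' N1 N1' ..
  interpret T2: tensor_lagrangians pair bar B C B' C' N2 N2' ..
  have mem: "(pair (x, x'), pair (z, z')) \<in>
      lagrangian_comp (A \<otimes>\<^sub>p A') (B \<otimes>\<^sub>p B') (C \<otimes>\<^sub>p C') (relation_sum pair N1 N1') (relation_sum pair N2 N2') \<longleftrightarrow>
      (x, z) \<in> lagrangian_comp A B C N1 N2 \<and> (x', z') \<in> lagrangian_comp A' B' C' N1' N2'" (is "?L \<longleftrightarrow> ?R")
    for x x' z z'
  proof
    assume ?L
    then obtain r w where *: "x \<in> elems A" "x' \<in> elems A'" "z \<in> elems C" "z' \<in> elems C'" "r \<noteq> 0"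
        "w \<in> elems T1.TB.T" "(r \<odot>\<^bsub>fst T1.TA.T\<^esub> pair (x, x'), w) \<in> relation_sum pair N1 N1'"
        "(w, r \<odot>\<^bsub>fst T2.TB.T\<^esub> pair (z, z')) \<in> relation_sum pair N2 N2'"
      by (auto simp: mem_lagrangian_comp)
    from *(6) obtain y y' where w: "w = pair (y, y')" "y \<in> elems B" "y' \<in> elems B'"
      by (rule T1.TB.tensor_cases)
    have "(r \<odot>\<^bsub>fst A\<^esub> x, y) \<in> N1" "(r \<odot>\<^bsub>fst A'\<^esub> x', y') \<in> N1'"
      "(y, r \<odot>\<^bsub>fst C\<^esub> z) \<in> N2" "(y', r \<odot>\<^bsub>fst C'\<^esub> z') \<in> N2'"
      using * w by (simp_all add: T1.TA.tensor_smult T2.TB.tensor_smult)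
    then show ?R using * w unfolding mem_lagrangian_comp by blast
  next
    assume ?R
    then obtain r y r' y' where *: "x \<in> elems A" "z \<in> elems C" "r \<noteq> 0" "(r \<odot>\<^bsub>fst A\<^esub> x, y) \<in> N1"
        "(y, r \<odot>\<^bsub>fst C\<^esub> z) \<in> N2" "x' \<in> elems A'" "z' \<in> elems C'" "r' \<noteq> 0" "(r' \<odot>\<^bsub>fst A'\<^esub> x', y') \<in> N1'"
        "(y', r' \<odot>\<^bsub>fst C'\<^esub> z') \<in> N2'"
      by (auto simp: mem_lagrangian_comp)
    \<comment> \<open>The two composites carry separate multipliers \<open>r\<close> and
      \<open>r'\<close>. Their product serves both once each middle element is scaled by the
      multiplier of the other.\<close>
    let ?y = "pair (r' \<odot>\<^bsub>fst B\<^esub> y, r \<odot>\<^bsub>fst B'\<^esub> y')"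
    have "((r * r') \<odot>\<^bsub>fst T1.TA.T\<^esub> pair (x, x'), ?y) \<in> relation_sum pair N1 N1'"
      using * N1.smult[OF *(4), of r'] N1'.smult[OF *(9), of r]
      by (simp add: T1.TA.tensor_smult N1.A.smult_smult N1'.A.smult_smult mult.commute)
    moreover have "(?y, (r * r') \<odot>\<^bsub>fst T2.TB.T\<^esub> pair (z, z')) \<in> relation_sum pair N2 N2'"
      using * N2.smult[OF *(5), of r'] N2'.smult[OF *(10), of r]
      by (simp add: T2.TB.tensor_smult N2.B.smult_smult N2'.B.smult_smult mult.commute)
    moreover have "?y \<in> elems T1.TB.T" using N1.memD(2)[OF *(4)] N1'.memD(2)[OF *(9)] by simp
    moreover have "pair (x, x') \<in> elems T1.TA.T" "pair (z, z') \<in> elems T2.TB.T" "r * r' \<noteq> 0"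
      using * by simp_all
    ultimately show ?L unfolding mem_lagrangian_comp by blast
  qed
  show ?thesis
  proof (intro Set.set_eqI iffI)
    fix p assume "p \<in> relation_sum pair (lagrangian_comp A B C N1 N2) (lagrangian_comp A' B' C' N1' N2')"
    then show "p \<in> lagrangian_comp (A \<otimes>\<^sub>p A') (B \<otimes>\<^sub>p B') (C \<otimes>\<^sub>p C') (relation_sum pair N1 N1') (relation_sum pair N2 N2')"
      using mem by (auto simp: relation_sum_def[of pair "lagrangian_comp A B C N1 N2"])
  next
    fix p assume p: "p \<in> lagrangian_comp (A \<otimes>\<^sub>p A') (B \<otimes>\<^sub>p B') (C \<otimes>\<^sub>p C') (relation_sum pair N1 N1') (relation_sum pair N2 N2')"
    then have "fst p \<in> elems T1.TA.T" "snd p \<in> elems T2.TB.T"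
      by (cases p; simp add: mem_lagrangian_comp)+
    then obtain x x' z z' where "fst p = pair (x, x')" "snd p = pair (z, z')"
      by (metis T1.TA.tensor_cases T2.TB.tensor_cases)
    then have "p = (pair (x, x'), pair (z, z'))" by (cases p) simp
    then show "p \<in> relation_sum pair (lagrangian_comp A B C N1 N2) (lagrangian_comp A' B' C' N1' N2')"
      using p mem by simp
  qed
qed

end

section \<open>The monoidal category\<close>

definition graph_arrow ::
  "('a::idom, 'u) pointed_module \<Rightarrow> ('a, 'u) pointed_module \<Rightarrow> ('u \<Rightarrow> 'u) \<Rightarrow> ('a, 'u) pointed_relation" where
  "graph_arrow A B \<phi> = (A, B, {(x, \<phi> x) | x. x \<in> elems A})"

text \<open>Reduces coherence to pointwise identities on elements, where the codes can be
  unpacked.\<close>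

lemma graph_arrow_cong: "(\<And>x. x \<in> elems A \<Longrightarrow> \<phi> x = \<psi> x) \<Longrightarrow> graph_arrow A B \<phi> = graph_arrow A B \<psi>"
  by (auto simp: graph_arrow_def)

context involutive_pairing
begin

definition V :: "(('a, 'u) pointed_module, ('a, 'u) pointed_relation) monoidal_category" where
  "V = \<lparr>Ob = Ob (pLagr bar), Ar = Ar (pLagr bar), Dom = Dom (pLagr bar), Cod = Cod (pLagr bar),
    Ident = Ident (pLagr bar), Comp = Comp (pLagr bar),
    tensor_ob = tensor_object bar pair,
    tensor_ar = (\<lambda>(A, B, N) (A', B', N'). (A \<otimes>\<^sub>p A', B \<otimes>\<^sub>p B', relation_sum pair N N')),
    unit_ob = unit_object,
    associator = (\<lambda>A B D. graph_arrow ((A \<otimes>\<^sub>p B) \<otimes>\<^sub>p D) (A \<otimes>\<^sub>p (B \<otimes>\<^sub>p D)) assoc_map),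
    lunitor = (\<lambda>A. graph_arrow (unit_object \<otimes>\<^sub>p A) A (\<lambda>v. snd (unpair v))),
    runitor = (\<lambda>A. graph_arrow (A \<otimes>\<^sub>p unit_object) A (\<lambda>v. fst (unpair v)))\<rparr>"

lemma V_simps [simp]:
  "Ob V = {A. obj A}"
  "Ident V A = graph_arrow A A (\<lambda>x. x)"
  "(B', D, N2) \<cdot>\<^bsub>V\<^esub> (A, B, N1) = (A, D, lagrangian_comp A B D N1 N2)"
  "A \<boxtimes>\<^bsub>V\<^esub> B = A \<otimes>\<^sub>p B"
  "(A, B, N) \<star>\<^bsub>V\<^esub> (A', B', N') = (A \<otimes>\<^sub>p A', B \<otimes>\<^sub>p B', relation_sum pair N N')"
  "unit_ob V = unit_object"
  "associator V A B D = graph_arrow ((A \<otimes>\<^sub>p B) \<otimes>\<^sub>p D) (A \<otimes>\<^sub>p (B \<otimes>\<^sub>p D)) assoc_map"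
  "lunitor V A = graph_arrow (unit_object \<otimes>\<^sub>p A) A (\<lambda>v. snd (unpair v))"
  "runitor V A = graph_arrow (A \<otimes>\<^sub>p unit_object) A (\<lambda>v. fst (unpair v))"
  using involution
  by (auto simp: V_def pLagr_def graph_arrow_def lagrangian_comp_def pointed_object_def)

lemma hom_iff: "f \<in> Hom V A B \<longleftrightarrow> (\<exists>N. f = (A, B, N) \<and> pointed_lagrangian bar A B N)"
  using involution
  by (cases f) (auto simp: V_def pLagr_def Hom_def pointed_lagrangian_def pointed_object_def
      pointed_lagrangian_axioms_def)

lemma homE:
  assumes "f \<in> Hom V A B"
  obtains N where "f = (A, B, N)" "pointed_lagrangian bar A B N"
  using assms by (auto simp: hom_iff)

lemma hom_obj:
  assumes "f \<in> Hom V A B"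
  shows "obj A" "obj B"
proof -
  obtain N where "pointed_lagrangian bar A B N" using assms by (rule homE)
  then show "obj A" "obj B" by (simp_all add: pointed_lagrangian_def)
qed

lemma hom_elems:
  assumes "(A, B, N) \<in> Hom V A B" "(x, y) \<in> N"
  shows "x \<in> elems A" "y \<in> elems B"
proof -
  have "pointed_lagrangian bar A B N" using assms(1) by (simp add: hom_iff)
  then show "x \<in> elems A" "y \<in> elems B"
    using assms(2) by (rule pointed_lagrangian.memD)+
qed

lemma graph_arrow_hom: "obj A \<Longrightarrow> obj B \<Longrightarrow> isometry A B \<phi> \<Longrightarrow> graph_arrow A B \<phi> \<in> Hom V A B"
  by (simp add: hom_iff graph_arrow_def isometry_graph)

lemma comp_graph_arrow:
  assumes "obj A" "isometry A B \<phi>" "(B, D, N) \<in> Hom V B D"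
  shows "(B, D, N) \<cdot>\<^bsub>V\<^esub> graph_arrow A B \<phi> = (A, D, {(x, z). x \<in> elems A \<and> (\<phi> x, z) \<in> N})"
proof -
  have "pointed_lagrangian bar B D N" using assms(3) by (auto simp: hom_iff)
  then show ?thesis using comp_isometry_left[OF assms(1,2)] by (simp add: graph_arrow_def)
qed

lemma graph_arrow_comp:
  assumes "obj D" "isometry B D \<phi>" "(A, B, N) \<in> Hom V A B"
  shows "graph_arrow B D \<phi> \<cdot>\<^bsub>V\<^esub> (A, B, N) = (A, D, {(x, \<phi> y) | x y. (x, y) \<in> N})"
proof -
  have "pointed_lagrangian bar A B N" using assms(3) by (auto simp: hom_iff)
  then show ?thesis using comp_isometry_right[OF assms(1,2)] by (simp add: graph_arrow_def)
qed

lemma graph_arrow_comp_graph_arrow: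
  assumes "obj A" "obj B" "obj D" "isometry A B \<phi>" "isometry B D \<psi>"
  shows "graph_arrow B D \<psi> \<cdot>\<^bsub>V\<^esub> graph_arrow A B \<phi> = graph_arrow A D (\<lambda>x. \<psi> (\<phi> x))"
  using comp_graph_arrow[OF assms(1,4) graph_arrow_hom[OF assms(2,3,5), unfolded graph_arrow_def]]
    isometryD(1)[OF assms(4)] by (auto simp: graph_arrow_def)

lemma graph_arrow_tensor:
  assumes "obj A" "obj A'"
  shows "graph_arrow A B \<phi> \<star>\<^bsub>V\<^esub> graph_arrow A' B' \<psi> =
    graph_arrow (A \<otimes>\<^sub>p A') (B \<otimes>\<^sub>p B') (pair_map \<phi> \<psi>)"
proof -
  interpret tensor_pair pair bar A A' by (rule tensor_pairI[OF assms])
  show ?thesis by (auto simp: graph_arrow_def relation_sum_def tensor_elems image_iff)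
qed

lemma isometry_is_iso:
  assumes "obj A" "obj B" "isometry A B \<phi>"
  shows "is_iso V A B (graph_arrow A B \<phi>)"
proof -
  let ?\<psi> = "inv_into (elems A) \<phi>"
  have \<psi>: "isometry B A ?\<psi>"
    by (rule isometry_inv_into[OF assms(3)]) (auto dest: pointed_object.point_memD(1)[OF assms(1)])
  have "graph_arrow B A ?\<psi> \<cdot>\<^bsub>V\<^esub> graph_arrow A B \<phi> = Ident V A"
    using graph_arrow_comp_graph_arrow[OF assms(1,2,1,3) \<psi>] isometryD(5)[OF assms(3)]
    by (auto intro!: graph_arrow_cong)
  moreover have "graph_arrow A B \<phi> \<cdot>\<^bsub>V\<^esub> graph_arrow B A ?\<psi> = Ident V B"
  proof -
    have "graph_arrow B B (\<lambda>x. \<phi> (?\<psi> x)) = graph_arrow B B (\<lambda>x. x)"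
    proof (rule graph_arrow_cong)
      fix x assume "x \<in> elems B"
      then have "x \<in> \<phi> ` elems A" using isometryD(3)[OF assms(3)] by blast
      then show "\<phi> (?\<psi> x) = x" by (rule f_inv_into_f)
    qed
    then show ?thesis using graph_arrow_comp_graph_arrow[OF assms(2,1,2) \<psi> assms(3)] by simp
  qed
  ultimately show ?thesis
    unfolding is_iso_def using graph_arrow_hom assms \<psi> by blast
qed

section \<open>The category laws\<close>

lemma category_V: "category V"
proof
  show "Dom V f \<in> Ob V" "Cod V f \<in> Ob V" if "f \<in> Ar V" for f
    using that involution by (auto simp: V_def pLagr_def)
  show "Ident V A \<in> Hom V A A" if "A \<in> Ob V" for A
    using that isometry_id[of bar A] by (simp add: graph_arrow_hom)
  show "g \<cdot>\<^bsub>V\<^esub> f \<in> Hom V A D" if fg: "f \<in> Hom V A B" "g \<in> Hom V B D" for f g A B D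
  proof -
    obtain N1 where f: "f = (A, B, N1)" "pointed_lagrangian bar A B N1" using fg(1) by (rule homE)
    obtain N2 where g: "g = (B, D, N2)" "pointed_lagrangian bar B D N2" using fg(2) by (rule homE)
    interpret composable_lagrangians bar A B D N1 N2 using f(2) g(2) by (rule composable_lagrangians.intro)
    show ?thesis unfolding hom_iff f(1) g(1) using pointed_lagrangian_comp by simp
  qed
  show "f \<cdot>\<^bsub>V\<^esub> Ident V A = f" if f: "f \<in> Hom V A B" for f A B
  proof -
    obtain N where N: "f = (A, B, N)" using f by (rule homE)
    have "{(x, z). x \<in> elems A \<and> (x, z) \<in> N} = N" using hom_elems(1)[OF f[unfolded N]] by auto
    then show ?thesis
      using comp_graph_arrow[OF hom_obj(1)[OF f] isometry_id[OF hom_obj(1)[OF f]] f[unfolded N]]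
      by (simp add: N)
  qed
  show "Ident V B \<cdot>\<^bsub>V\<^esub> f = f" if f: "f \<in> Hom V A B" for f A B
  proof -
    obtain N where N: "f = (A, B, N)" using f by (rule homE)
    show ?thesis
      using graph_arrow_comp[OF hom_obj(2)[OF f] isometry_id[OF hom_obj(2)[OF f]] f[unfolded N]]
      by (simp add: N)
  qed
  show "(h \<cdot>\<^bsub>V\<^esub> g) \<cdot>\<^bsub>V\<^esub> f = h \<cdot>\<^bsub>V\<^esub> (g \<cdot>\<^bsub>V\<^esub> f)"
    if fgh: "f \<in> Hom V A B" "g \<in> Hom V B D" "h \<in> Hom V D E" for f g h A B D E
  proof -
    obtain N1 where f: "f = (A, B, N1)" "pointed_lagrangian bar A B N1" using fgh(1) by (rule homE)
    obtain N2 where g: "g = (B, D, N2)" "pointed_lagrangian bar B D N2" using fgh(2) by (rule homE)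
    obtain N3 where h: "h = (D, E, N3)" "pointed_lagrangian bar D E N3" using fgh(3) by (rule homE)
    show ?thesis using lagrangian_comp_assoc[OF f(2) g(2) h(2)] by (simp add: f(1) g(1) h(1))
  qed
qed

section \<open>Functoriality, naturality and coherence\<close>

lemma tensor_ar_hom:
  assumes "f \<in> Hom V A B" "f' \<in> Hom V A' B'"
  shows "f \<star>\<^bsub>V\<^esub> f' \<in> Hom V (A \<otimes>\<^sub>p A') (B \<otimes>\<^sub>p B')"
proof -
  obtain N where f: "f = (A, B, N)" "pointed_lagrangian bar A B N" using assms(1) by (rule homE)
  obtain N' where f': "f' = (A', B', N')" "pointed_lagrangian bar A' B' N'" using assms(2) by (rule homE)
  interpret tensor_lagrangians pair bar A B A' B' N N'
    using pairing_axioms f(2) f'(2) by (rule tensor_lagrangians.intro)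
  show ?thesis unfolding hom_iff f(1) f'(1) using tensor_lagrangian by simp
qed

lemma tensor_comp:
  assumes "f \<in> Hom V A B" "g \<in> Hom V B D" "f' \<in> Hom V A' B'" "g' \<in> Hom V B' D'"
  shows "(g \<cdot>\<^bsub>V\<^esub> f) \<star>\<^bsub>V\<^esub> (g' \<cdot>\<^bsub>V\<^esub> f') = (g \<star>\<^bsub>V\<^esub> g') \<cdot>\<^bsub>V\<^esub> (f \<star>\<^bsub>V\<^esub> f')"
proof -
  obtain N1 where f: "f = (A, B, N1)" "pointed_lagrangian bar A B N1" using assms(1) by (rule homE)
  obtain N2 where g: "g = (B, D, N2)" "pointed_lagrangian bar B D N2" using assms(2) by (rule homE)
  obtain N1' where f': "f' = (A', B', N1')" "pointed_lagrangian bar A' B' N1'"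
    using assms(3) by (rule homE)
  obtain N2' where g': "g' = (B', D', N2')" "pointed_lagrangian bar B' D' N2'"
    using assms(4) by (rule homE)
  show ?thesis using relation_sum_comp[OF f(2) g(2) f'(2) g'(2)] by (simp add: f(1) g(1) f'(1) g'(1))
qed

text \<open>Composing with a graph on either side leaves no multiplier, so both sides are explicit
  relations: they relate ((a, b), d) to (a', (b', d')) exactly when the components are related by
  \<open>F\<close>, \<open>G\<close> and \<open>H\<close>.\<close>

lemma associator_natural:
  assumes "f \<in> Hom V A A'" "g \<in> Hom V B B'" "h \<in> Hom V D D'"
  shows "associator V A' B' D' \<cdot>\<^bsub>V\<^esub> ((f \<star>\<^bsub>V\<^esub> g) \<star>\<^bsub>V\<^esub> h) =
    (f \<star>\<^bsub>V\<^esub> (g \<star>\<^bsub>V\<^esub> h)) \<cdot>\<^bsub>V\<^esub> associator V A B D"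
proof -
  obtain F where F: "f = (A, A', F)" using assms(1) by (rule homE)
  obtain G where G: "g = (B, B', G)" using assms(2) by (rule homE)
  obtain H where H: "h = (D, D', H)" using assms(3) by (rule homE)
  note f = F G H
  note o = hom_obj[OF assms(1)] hom_obj[OF assms(2)] hom_obj[OF assms(3)]
  have L: "(f \<star>\<^bsub>V\<^esub> g) \<star>\<^bsub>V\<^esub> h \<in> Hom V ((A \<otimes>\<^sub>p B) \<otimes>\<^sub>p D) ((A' \<otimes>\<^sub>p B') \<otimes>\<^sub>p D')"
    and R: "f \<star>\<^bsub>V\<^esub> (g \<star>\<^bsub>V\<^esub> h) \<in> Hom V (A \<otimes>\<^sub>p (B \<otimes>\<^sub>p D)) (A' \<otimes>\<^sub>p (B' \<otimes>\<^sub>p D'))"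
    using assms by (auto intro!: tensor_ar_hom)
  have "{(x, assoc_map y) | x y. (x, y) \<in> relation_sum pair (relation_sum pair F G) H} =
      {(x, z). x \<in> elems ((A \<otimes>\<^sub>p B) \<otimes>\<^sub>p D) \<and> (assoc_map x, z) \<in> relation_sum pair F (relation_sum pair G H)}"
    (is "?L = ?R")
  proof (intro Set.set_eqI iffI)
    fix p assume "p \<in> ?L"
    then obtain a b d a' b' d' where
      p: "p = (pair (pair (a, b), d), pair (a', pair (b', d')))" "(a, a') \<in> F" "(b, b') \<in> G" "(d, d') \<in> H"
      unfolding relation_sum_def by fastforce
    then have "(pair (pair (a, b), d), pair (pair (a', b'), d')) \<in> relation_sum pair (relation_sum pair F G) H"
      by simp
    then have "pair (pair (a, b), d) \<in> elems ((A \<otimes>\<^sub>p B) \<otimes>\<^sub>p D)"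
      by (rule hom_elems(1)[OF L[unfolded f V_simps]])
    then show "p \<in> ?R" using p by simp
  next
    fix p assume "p \<in> ?R"
    then obtain x z where p: "p = (x, z)" "x \<in> elems ((A \<otimes>\<^sub>p B) \<otimes>\<^sub>p D)"
        "(assoc_map x, z) \<in> relation_sum pair F (relation_sum pair G H)" by blast
    from p(2) obtain a b d where x: "x = pair (pair (a, b), d)"
      using tensor_pair.tensor_elems[OF tensor_pairI] obj_tensor o by (auto simp: image_iff)
    from p(3) obtain a' b' d' where "z = pair (a', pair (b', d'))" "(a, a') \<in> F" "(b, b') \<in> G" "(d, d') \<in> H"
      unfolding x by (auto simp: relation_sum_def)
    then have "(x, pair (pair (a', b'), d')) \<in> relation_sum pair (relation_sum pair F G) H"
        "z = assoc_map (pair (pair (a', b'), d'))"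
      using x by simp_all
    then show "p \<in> ?L" using p(1) by blast
  qed
  then show ?thesis
    using graph_arrow_comp[OF _ isometry_assoc_map L[unfolded f V_simps]]
      comp_graph_arrow[OF _ isometry_assoc_map R[unfolded f V_simps]] o
    by (simp add: f obj_tensor)
qed

lemma lunitor_natural:
  assumes "f \<in> Hom V A B"
  shows "lunitor V B \<cdot>\<^bsub>V\<^esub> (Ident V (unit_ob V) \<star>\<^bsub>V\<^esub> f) = f \<cdot>\<^bsub>V\<^esub> lunitor V A"
proof -
  obtain N where f: "f = (A, B, N)" using assms by (rule homE)
  note o = hom_obj[OF assms]
  let ?I = "{(x, x) | x. x \<in> elems (unit_object :: ('a, 'u) pointed_module)}"
  have L: "(unit_object \<otimes>\<^sub>p A, unit_object \<otimes>\<^sub>p B, relation_sum pair ?I N) \<in>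
      Hom V (unit_object \<otimes>\<^sub>p A) (unit_object \<otimes>\<^sub>p B)"
    using tensor_ar_hom[OF graph_arrow_hom[OF obj_unit obj_unit isometry_id[OF obj_unit]] assms]
    by (simp add: graph_arrow_def f)
  have "{(x, snd (unpair y)) | x y. (x, y) \<in> relation_sum pair ?I N} =
      {(x, z). x \<in> elems (unit_object \<otimes>\<^sub>p A) \<and> (snd (unpair x), z) \<in> N}"
    using hom_elems(1)[OF assms[unfolded f]]
    by (auto simp: relation_sum_def tensor_pair.tensor_elems[OF tensor_pairI[OF obj_unit o(1)]])
      (metis snd_conv unpair_pair)
  then show ?thesis
    using graph_arrow_comp[OF o(2) isometry_lunit[OF o(2)] L]
      comp_graph_arrow[OF obj_tensor[OF obj_unit o(1)] isometry_lunit[OF o(1)] assms[unfolded f]]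
    by (simp add: f graph_arrow_def)
qed

lemma runitor_natural:
  assumes "f \<in> Hom V A B"
  shows "runitor V B \<cdot>\<^bsub>V\<^esub> (f \<star>\<^bsub>V\<^esub> Ident V (unit_ob V)) = f \<cdot>\<^bsub>V\<^esub> runitor V A"
proof -
  obtain N where f: "f = (A, B, N)" using assms by (rule homE)
  note o = hom_obj[OF assms]
  let ?I = "{(x, x) | x. x \<in> elems (unit_object :: ('a, 'u) pointed_module)}"
  have L: "(A \<otimes>\<^sub>p unit_object, B \<otimes>\<^sub>p unit_object, relation_sum pair N ?I) \<in>
      Hom V (A \<otimes>\<^sub>p unit_object) (B \<otimes>\<^sub>p unit_object)"
    using tensor_ar_hom[OF assms graph_arrow_hom[OF obj_unit obj_unit isometry_id[OF obj_unit]]]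
    by (simp add: graph_arrow_def f)
  have "{(x, fst (unpair y)) | x y. (x, y) \<in> relation_sum pair N ?I} =
      {(x, z). x \<in> elems (A \<otimes>\<^sub>p unit_object) \<and> (fst (unpair x), z) \<in> N}"
    using hom_elems(1)[OF assms[unfolded f]]
    by (auto simp: relation_sum_def tensor_pair.tensor_elems[OF tensor_pairI[OF o(1) obj_unit]])
      (metis fst_conv unpair_pair)
  then show ?thesis
    using graph_arrow_comp[OF o(2) isometry_runit[OF o(2)] L]
      comp_graph_arrow[OF obj_tensor[OF o(1) obj_unit] isometry_runit[OF o(1)] assms[unfolded f]]
    by (simp add: f graph_arrow_def)
qed

text \<open>Every arrow involved is a graph, so it suffices that both composite maps send (((a, b),
  d), e) to (a, (b, (d, e))).\<close>

lemma pentagon: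
  assumes "obj A" "obj B" "obj D" "obj E"
  shows "associator V A B (D \<otimes>\<^sub>p E) \<cdot>\<^bsub>V\<^esub> associator V (A \<otimes>\<^sub>p B) D E =
    (Ident V A \<star>\<^bsub>V\<^esub> associator V B D E) \<cdot>\<^bsub>V\<^esub> associator V A (B \<otimes>\<^sub>p D) E
      \<cdot>\<^bsub>V\<^esub> (associator V A B D \<star>\<^bsub>V\<^esub> Ident V E)"
proof -
  note o = assms obj_tensor
  have 1: "isometry (((A \<otimes>\<^sub>p B) \<otimes>\<^sub>p D) \<otimes>\<^sub>p E) ((A \<otimes>\<^sub>p (B \<otimes>\<^sub>p D)) \<otimes>\<^sub>p E) (pair_map assoc_map (\<lambda>x. x))"
    by (intro isometry_tensor isometry_assoc_map isometry_id[of bar] o)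
  have 2: "isometry ((A \<otimes>\<^sub>p (B \<otimes>\<^sub>p D)) \<otimes>\<^sub>p E) (A \<otimes>\<^sub>p ((B \<otimes>\<^sub>p D) \<otimes>\<^sub>p E)) assoc_map"
    by (intro isometry_assoc_map o)
  have 3: "isometry (A \<otimes>\<^sub>p ((B \<otimes>\<^sub>p D) \<otimes>\<^sub>p E)) (A \<otimes>\<^sub>p (B \<otimes>\<^sub>p (D \<otimes>\<^sub>p E))) (pair_map (\<lambda>x. x) assoc_map)"
    by (intro isometry_tensor isometry_assoc_map isometry_id[of bar] o)
  \<comment> \<open>Graphs are merged two at a time; this is the inner composite of the right-hand
    side, to be followed by the map of \<open>3\<close>.\<close>
  have 12: "isometry (((A \<otimes>\<^sub>p B) \<otimes>\<^sub>p D) \<otimes>\<^sub>p E) (A \<otimes>\<^sub>p ((B \<otimes>\<^sub>p D) \<otimes>\<^sub>p E))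
      (\<lambda>v. assoc_map (pair_map assoc_map (\<lambda>x. x) v))"
    by (intro isometry_comp[of bar, OF _ _ _ 1 2] o)
  have "graph_arrow (((A \<otimes>\<^sub>p B) \<otimes>\<^sub>p D) \<otimes>\<^sub>p E) (A \<otimes>\<^sub>p (B \<otimes>\<^sub>p (D \<otimes>\<^sub>p E))) (\<lambda>v. assoc_map (assoc_map v)) =
      graph_arrow (((A \<otimes>\<^sub>p B) \<otimes>\<^sub>p D) \<otimes>\<^sub>p E) (A \<otimes>\<^sub>p (B \<otimes>\<^sub>p (D \<otimes>\<^sub>p E)))
        (\<lambda>v. pair_map (\<lambda>x. x) assoc_map (assoc_map (pair_map assoc_map (\<lambda>x. x) v)))"
  proof (rule graph_arrow_cong)
    fix v assume "v \<in> elems (((A \<otimes>\<^sub>p B) \<otimes>\<^sub>p D) \<otimes>\<^sub>p E)"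
    then obtain a b d e where "v = pair (pair (pair (a, b), d), e)"
      using tensor_pair.tensor_elems[OF tensor_pairI] by (auto simp: image_iff o)
    then show "assoc_map (assoc_map v) = pair_map (\<lambda>x. x) assoc_map (assoc_map (pair_map assoc_map (\<lambda>x. x) v))"
      by simp
  qed
  then show ?thesis
    by (simp add: graph_arrow_tensor graph_arrow_comp_graph_arrow isometry_assoc_map 1 3 12 o)
qed

text \<open>As for the pentagon, both sides are graphs; on ((a, u), b) with \<open>u\<close> from
  the unit, both maps drop \<open>u\<close>.\<close>

lemma triangle:
  assumes "obj A" "obj B"
  shows "(Ident V A \<star>\<^bsub>V\<^esub> lunitor V B) \<cdot>\<^bsub>V\<^esub> associator V A (unit_ob V) B =
    runitor V A \<star>\<^bsub>V\<^esub> Ident V B"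
proof -
  have "graph_arrow ((A \<otimes>\<^sub>p unit_object) \<otimes>\<^sub>p B) (A \<otimes>\<^sub>p B)
        (\<lambda>v. pair_map (\<lambda>x. x) (\<lambda>v. snd (unpair v)) (assoc_map v)) =
      graph_arrow ((A \<otimes>\<^sub>p unit_object) \<otimes>\<^sub>p B) (A \<otimes>\<^sub>p B) (pair_map (\<lambda>v. fst (unpair v)) (\<lambda>x. x))"
  proof (rule graph_arrow_cong)
    fix v assume "v \<in> elems ((A \<otimes>\<^sub>p unit_object) \<otimes>\<^sub>p B)"
    then obtain a u b where "v = pair (pair (a, u), b)"
      using tensor_pair.tensor_elems[OF tensor_pairI] assms obj_unit obj_tensor by (auto simp: image_iff)
    then show "pair_map (\<lambda>x. x) (\<lambda>v. snd (unpair v)) (assoc_map v) = pair_map (\<lambda>v. fst (unpair v)) (\<lambda>x. x) v"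
      by simp
  qed
  then show ?thesis
    by (simp add: graph_arrow_tensor graph_arrow_comp_graph_arrow assms obj_unit obj_tensor
        isometry_assoc_map isometry_tensor isometry_id[of bar] isometry_lunit)
qed

lemma monoidal_category_V: "monoidal_category V"
proof (intro monoidal_category.intro monoidal_category_axioms.intro category_V)
  show "Ident V A \<star>\<^bsub>V\<^esub> Ident V B = Ident V (A \<boxtimes>\<^bsub>V\<^esub> B)" if "A \<in> Ob V" "B \<in> Ob V" for A B
  proof -
    have "graph_arrow (A \<otimes>\<^sub>p B) (A \<otimes>\<^sub>p B) (pair_map (\<lambda>x. x) (\<lambda>x. x)) = graph_arrow (A \<otimes>\<^sub>p B) (A \<otimes>\<^sub>p B) (\<lambda>x. x)"
      using tensor_pair.tensor_elems[OF tensor_pairI[of A B]] that by (intro graph_arrow_cong) auto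
    then show ?thesis using that by (simp add: graph_arrow_tensor)
  qed
  show "is_iso V ((A \<boxtimes>\<^bsub>V\<^esub> B) \<boxtimes>\<^bsub>V\<^esub> D) (A \<boxtimes>\<^bsub>V\<^esub> (B \<boxtimes>\<^bsub>V\<^esub> D)) (associator V A B D)"
    if "A \<in> Ob V" "B \<in> Ob V" "D \<in> Ob V" for A B D
    using that by (simp add: isometry_is_iso isometry_assoc_map obj_tensor)
  show "is_iso V (unit_ob V \<boxtimes>\<^bsub>V\<^esub> A) A (lunitor V A)" if "A \<in> Ob V" for A
    using that by (simp add: isometry_is_iso isometry_lunit obj_tensor obj_unit)
  show "is_iso V (A \<boxtimes>\<^bsub>V\<^esub> unit_ob V) A (runitor V A)" if "A \<in> Ob V" for A
    using that by (simp add: isometry_is_iso isometry_runit obj_tensor obj_unit)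
  show "associator V A B (D \<boxtimes>\<^bsub>V\<^esub> E) \<cdot>\<^bsub>V\<^esub> associator V (A \<boxtimes>\<^bsub>V\<^esub> B) D E =
      (Ident V A \<star>\<^bsub>V\<^esub> associator V B D E) \<cdot>\<^bsub>V\<^esub> associator V A (B \<boxtimes>\<^bsub>V\<^esub> D) E
        \<cdot>\<^bsub>V\<^esub> (associator V A B D \<star>\<^bsub>V\<^esub> Ident V E)"
    if "A \<in> Ob V" "B \<in> Ob V" "D \<in> Ob V" "E \<in> Ob V" for A B D E
    using that pentagon[of A B D E] by (simp only: V_simps mem_Collect_eq)
  show "(Ident V A \<star>\<^bsub>V\<^esub> lunitor V B) \<cdot>\<^bsub>V\<^esub> associator V A (unit_ob V) B = runitor V A \<star>\<^bsub>V\<^esub> Ident V B"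
    if "A \<in> Ob V" "B \<in> Ob V" for A B
    using that by (intro triangle) simp_all
  show "f \<star>\<^bsub>V\<^esub> f' \<in> Hom V (A \<boxtimes>\<^bsub>V\<^esub> A') (B \<boxtimes>\<^bsub>V\<^esub> B')" if "f \<in> Hom V A B" "f' \<in> Hom V A' B'" for f f' A B A' B'
    using tensor_ar_hom[OF that] by simp
  show "unit_ob V \<in> Ob V" by (simp add: obj_unit)
qed (simp_all add: obj_tensor tensor_comp associator_natural lunitor_natural runitor_natural
    del: V_simps(2,3,5-9))

end

theorem proposition2p3:
  fixes bar :: "'a::idom \<Rightarrow> 'a" and pair :: "'u \<times> 'u \<Rightarrow> 'u"
  assumes "ring_involution bar" and "inj pair"
  shows "\<exists>V :: (('a, 'u) pointed_module, ('a, 'u) pointed_relation) monoidal_category.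
    monoidal_category V \<and> category.truncate V = pLagr bar \<and>
    (\<forall>H \<rho> s H' \<rho>' s'. (H, \<rho>, s) \<in> Ob V \<longrightarrow> (H', \<rho>', s') \<in> Ob V \<longrightarrow>
      (H, \<rho>, s) \<boxtimes>\<^bsub>V\<^esub> (H', \<rho>', s') =
        transport pair (module_sum H H', twisted_form bar (H, \<rho>, s) (H', \<rho>', s'),
          fraction_pair s s')) \<and>
    (\<forall>A B A' B' N N'. (A, B, N) \<in> Ar V \<longrightarrow> (A', B', N') \<in> Ar V \<longrightarrow>
      (A, B, N) \<star>\<^bsub>V\<^esub> (A', B', N') =
        (A \<boxtimes>\<^bsub>V\<^esub> A', B \<boxtimes>\<^bsub>V\<^esub> B', relation_sum pair N N'))"
proof -
  interpret involutive_pairing pair bar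
    using assms by unfold_locales
  have "category.truncate V = pLagr bar"
    by (simp add: V_def category.truncate_def pLagr_def)
  then show ?thesis
    using monoidal_category_V by (intro exI[of _ V]) (simp add: tensor_object_def)
qed

end
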